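(* The Poisson operator induced on $\mathcal{M}_2(S^1)$ from the Poisson operator $L_{2j+1}=L_3(L_1^{-1}L_3)^{j-1}$ on $C^\infty(S^1,\mathbb{R})$ via the central affine curvature map $\Psi:\mathcal{M}_2(S^1)\to C^\infty(S^1,\mathbb{R})$ is $$(\hat L_{2j+1})_\gamma(\tilde\xi)=\widetilde{(J_{2j+1})_q(\xi)},\qquad J_{2j+1}=-\frac14(L_1^{-1}L_3)^{j-1}L_3^{-1},$$ where $q=\Psi(\gamma)$ and $j\geq0$. That is, for a functional $H$ on $C^\infty(S^1,\mathbb{R})$ with $\hat H=H\circ\Psi$, the Hamiltonian vector field of $\hat H$ for the induced Poisson structure is $\hat L_{2j+1}(\nabla\hat H)$.
   Context: $S^1=\mathbb{R}/2\pi\mathbb{Z}$ and $\oint$ is integration over $S^1$. $\mathcal{M}_2(S^1)$ is the set of smooth $\gamma:S^1\to\mathbb{R}^2\setminus\{0\}$ with $\det(\gamma,\gamma_x)=1$; $\Psi(\gamma)=q$ is the central affine curvature, i.e. the unique smooth function with $\gamma_{xx}=q\gamma$. The tangent space of $\mathcal{M}_2(S^1)$ at $\gamma$ is identified with $C^\infty(S^1,\mathbb{R})$ via $\xi\mapsto\tilde\xi=-\frac12\xi_x\gamma+\xi\gamma_x$. Gradients: for $H:C^\infty(S^1,\mathbb{R})\to\mathbb{R}$, $dH_q(v)=\oint(\nabla H(q))v\,dx$; for $\hat H$ on $\mathcal{M}_2(S^1)$, $\nabla\hat H(\gamma)=\tilde y$ where $d\hat H_\gamma(\tilde\xi)=\oint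 y\,\xi\,dx$ for all $\xi$. A Poisson operator on $C^\infty(S^1,\mathbb{R})$ is a family of skew-adjoint operators $L_q$ such that $\{F_1,F_2\}(q)=-\oint L_q(\nabla F_1(q))\,\nabla F_2(q)\,dx$ is a Poisson structure; the Hamiltonian vector field of $H$ is $L_q(\nabla H(q))$. Here $(L_1)_q(v)=v_x$, $(L_3)_q(v)=\frac14(v_{xxx}-4qv_x-2q_xv)$, and $\{\,,\}_{2j+1}$ denotes the bracket of $L_{2j+1}=L_3(L_1^{-1}L_3)^{j-1}$. The induced Poisson structure is $\{F_1\circ\Psi,F_2\circ\Psi\}_{2j+1}=\{F_1,F_2\}_{2j+1}\circ\Psi$, and the Hamiltonian vector field of $\hat H=H\circ\Psi$ with respect to it is a vector field $\tilde\xi$ that is mapped by $d\Psi_\gamma$ to $(L_{2j+1})_q(\nabla H(q))$. Inverses are formal (partial) inverses: $L_1^{-1}$ is defined on functions of mean zero, as an antiderivative (with $(L_1)_q^{-1}(p(q)_x)=p(q)$ for differential polynomials $p(q)$ in $q$ without constant term); $L_3^{-1}$ is defined on the image of $L_3$, with $L_3^{-1}L_3v=v$ formally (i.e. up to the finite-dimensional kernel, the same representative $v$ being chosen). The identity is asserted wherever the operators involved are defined. *)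

theory Defs
  imports "HOL-Analysis.Analysis"
begin

section \<open>Smooth maps on the circle\<close>

primrec Ck_on :: "nat \<Rightarrow> 'a::real_normed_vector set \<Rightarrow> ('a \<Rightarrow> 'b::real_normed_vector) \<Rightarrow> bool"
  where
    "Ck_on 0 S f \<longleftrightarrow> continuous_on S f"
  | "Ck_on (Suc k) S f \<longleftrightarrow>
       (\<forall>x\<in>S. f differentiable (at x)) \<and> (\<forall>v. Ck_on k S (\<lambda>x. frechet_derivative f (at x) v))"

text \<open>Used only for open \<^term>\<open>S\<close> in finite-dimensional spaces.\<close>

definition smooth_on :: "'a::real_normed_vector set \<Rightarrow> ('a \<Rightarrow> 'b::real_normed_vector) \<Rightarrow> bool"
  where "smooth_on S f \<longleftrightarrow> (\<forall>k. Ck_on k S f)"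

definition Dx :: "(real \<Rightarrow> 'b::real_normed_vector) \<Rightarrow> real \<Rightarrow> 'b"
  where "Dx f x = vector_derivative f (at x)"

text \<open>Functions on the circle \<open>S\<^sup>1 = \<real> / 2\<pi>\<int>\<close> are \<open>2\<pi>\<close>-periodic functions on the line.\<close>

definition smooth_circle :: "(real \<Rightarrow> 'b::real_normed_vector) set"
  where "smooth_circle = {f. smooth_on UNIV f \<and> (\<forall>x. f (x + 2 * pi) = f x)}"

definition circle_integral :: "(real \<Rightarrow> real) \<Rightarrow> real"
  where "circle_integral f = integral {0..2 * pi} f"

section \<open>Central affine curves and their curvature\<close>

definition M2 :: "(real \<Rightarrow> real^2) set"
  where "M2 = {\<gamma> \<in> smooth_circle. (\<forall>x. \<gamma> x \<noteq> 0) \<and>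
    (\<forall>x. det (vector [\<gamma> x, Dx \<gamma> x] :: real^2^2) = 1)}"

definition Psi :: "(real \<Rightarrow> real^2) \<Rightarrow> real \<Rightarrow> real"
  where "Psi \<gamma> = (THE q. q \<in> smooth_circle \<and> (\<forall>x. Dx (Dx \<gamma>) x = q x *\<^sub>R \<gamma> x))"

text \<open>The tangent vector of \<^term>\<open>M2\<close> at \<open>\<gamma>\<close> given by \<open>\<xi>\<close>, written
  \<open>\<xi>\<close> with a tilde in the literature.\<close>

definition tilde :: "(real \<Rightarrow> real^2) \<Rightarrow> (real \<Rightarrow> real) \<Rightarrow> real \<Rightarrow> real^2"
  where "tilde \<gamma> \<xi> = (\<lambda>x. (- (1/2) * Dx \<xi> x) *\<^sub>R \<gamma> x + \<xi> x *\<^sub>R Dx \<gamma> x)"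

section \<open>Differentials and gradients\<close>

text \<open>\<open>curve_through M c f V\<close>: near parameter 0, \<open>c\<close> is a smooth curve in \<open>M\<close> (jointly smooth in
  the parameter and the point of the circle) with \<open>c 0 = f\<close> and velocity \<open>V\<close> at 0.
  Differentials, both on the vector space of functions and on the space of curves, are taken along
  such curves.  For functions on a Frechet space this is a consequence of being continuously
  differentiable, and it is stable under composition.\<close>

definition curve_through ::
    "(real \<Rightarrow> 'b::real_normed_vector) set \<Rightarrow> (real \<Rightarrow> real \<Rightarrow> 'b) \<Rightarrow> (real \<Rightarrow> 'b) \<Rightarrow> (real \<Rightarrow> 'b) \<Rightarrow> bool"
  where "curve_through M c f V \<longleftrightarrow>
    (\<exists>\<epsilon>>0. smooth_on ({-\<epsilon><..<\<epsilon>} \<times> UNIV) (\<lambda>(t, x). c t x) \<and> (\<forall>t\<in>{-\<epsilon><..<\<epsilon>}. c t \<in> M)) \<and>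
    c 0 = f \<and> (\<forall>x. ((\<lambda>t. c t x) has_vector_derivative V x) (at 0))"

definition has_gradient :: "((real \<Rightarrow> real) \<Rightarrow> real) \<Rightarrow> (real \<Rightarrow> real) \<Rightarrow> (real \<Rightarrow> real) \<Rightarrow> bool"
  where "has_gradient H q g \<longleftrightarrow> g \<in> smooth_circle \<and>
    (\<forall>c v. curve_through smooth_circle c q v \<longrightarrow>
       ((\<lambda>t. H (c t)) has_real_derivative circle_integral (\<lambda>x. g x * v x)) (at 0))"

definition has_gradient_M2 ::
    "((real \<Rightarrow> real^2) \<Rightarrow> real) \<Rightarrow> (real \<Rightarrow> real^2) \<Rightarrow> (real \<Rightarrow> real^2) \<Rightarrow> bool"
  where "has_gradient_M2 G \<gamma> Y \<longleftrightarrow> (\<exists>y\<in>smooth_circle. Y = tilde \<gamma> y \<and>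
    (\<forall>c. \<forall>\<xi>\<in>smooth_circle. curve_through M2 c \<gamma> (tilde \<gamma> \<xi>) \<longrightarrow>
       ((\<lambda>t. G (c t)) has_real_derivative circle_integral (\<lambda>x. y x * \<xi> x)) (at 0)))"

text \<open>\<open>dPsi \<gamma> X p\<close>: \<open>X\<close> is tangent to \<^term>\<open>M2\<close> at \<open>\<gamma>\<close> and the differential of \<^term>\<open>Psi\<close> at
  \<open>\<gamma>\<close> maps \<open>X\<close> to \<open>p\<close>.\<close>

definition dPsi :: "(real \<Rightarrow> real^2) \<Rightarrow> (real \<Rightarrow> real^2) \<Rightarrow> (real \<Rightarrow> real) \<Rightarrow> bool"
  where "dPsi \<gamma> X p \<longleftrightarrow> (\<exists>c. curve_through M2 c \<gamma> X) \<and>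
    (\<forall>c. curve_through M2 c \<gamma> X \<longrightarrow> curve_through smooth_circle (\<lambda>t. Psi (c t)) (Psi \<gamma>) p)"

section \<open>The operators and their formal inverses\<close>

definition L1 :: "(real \<Rightarrow> real) \<Rightarrow> (real \<Rightarrow> real) \<Rightarrow> real \<Rightarrow> real"
  where "L1 q v = (\<lambda>x. Dx v x)"

definition L3 :: "(real \<Rightarrow> real) \<Rightarrow> (real \<Rightarrow> real) \<Rightarrow> real \<Rightarrow> real"
  where "L3 q v = (\<lambda>x. 1/4 * (Dx (Dx (Dx v)) x - 4 * q x * Dx v x - 2 * Dx q x * v x))"

text \<open>A formal inverse of \<^term>\<open>L1 q\<close> is a linear relation \<open>A\<close> that assigns antiderivatives to all
  functions of mean zero.  A single-valued \<open>A\<close> is a linear antiderivative operator.  Larger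
  \<open>A\<close>, up to the relation of all antiderivatives, are allowed because a normalisation such as
  \<open>L\<^sub>1\<^sup>-\<^sup>1 (p(q)\<^sub>x) = p(q)\<close> for all differential polynomials \<open>p\<close> without constant term is not
  a function of the value \<open>p(q)\<^sub>x\<close> at every \<open>q\<close>: at constant \<open>q\<close> all \<open>p(q)\<^sub>x\<close> vanish but the
  \<open>p(q)\<close> differ.\<close>

definition formal_inverse_L1 ::
    "(real \<Rightarrow> real) \<Rightarrow> ((real \<Rightarrow> real) \<times> (real \<Rightarrow> real)) set \<Rightarrow> bool"
  where "formal_inverse_L1 q A \<longleftrightarrow>
    A \<subseteq> {(u, v). u \<in> smooth_circle \<and> v \<in> smooth_circle \<and> L1 q v = u} \<and>
    Domain A = {u \<in> smooth_circle. circle_integral u = 0} \<and>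
    (\<forall>a b u v u' v'. (u, v) \<in> A \<longrightarrow> (u', v') \<in> A \<longrightarrow>
       ((\<lambda>x. a * u x + b * u' x), (\<lambda>x. a * v x + b * v' x)) \<in> A)"

text \<open>A formal inverse of \<^term>\<open>L3 q\<close> picks a preimage of each function in the image.\<close>

definition formal_inverse_L3 ::
    "(real \<Rightarrow> real) \<Rightarrow> ((real \<Rightarrow> real) \<Rightarrow> real \<Rightarrow> real) \<Rightarrow> bool"
  where "formal_inverse_L3 q B \<longleftrightarrow> (\<forall>u \<in> L3 q ` smooth_circle. B u \<in> smooth_circle \<and> L3 q (B u) = u)"

text \<open>Since \<^term>\<open>L3 q\<close> has a kernel, \<open>L\<^sub>3\<^sup>-\<^sup>1 L\<^sub>3 v = v\<close> is a condition on the choice of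
  preimages.\<close>

definition selects :: "(real \<Rightarrow> real) \<Rightarrow> ((real \<Rightarrow> real) \<Rightarrow> real \<Rightarrow> real) \<Rightarrow> (real \<Rightarrow> real) \<Rightarrow> bool"
  where "selects q B v \<longleftrightarrow> B (L3 q v) = v"

text \<open>From here on \<open>A\<close> and \<open>B\<close> stand for the chosen inverses of \<open>L\<^sub>1\<close> and \<open>L\<^sub>3\<close>, and a partially
  defined operator is the relation between its arguments and its values.\<close>

definition L1inv_L3 ::
    "(real \<Rightarrow> real) \<Rightarrow> ((real \<Rightarrow> real) \<times> (real \<Rightarrow> real)) set \<Rightarrow> ((real \<Rightarrow> real) \<times> (real \<Rightarrow> real)) set"
  where "L1inv_L3 q A = {(v, w). v \<in> smooth_circle \<and> (L3 q v, w) \<in> A}"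

text \<open>\<open>(L\<^sub>1\<^sup>-\<^sup>1 L\<^sub>3)\<^bsup>j-1\<^esup>\<close>; for \<open>j = 0\<close> this is \<open>L\<^sub>3\<^sup>-\<^sup>1 L\<^sub>1\<close>.\<close>

primrec L1inv_L3_power ::
    "(real \<Rightarrow> real) \<Rightarrow> ((real \<Rightarrow> real) \<times> (real \<Rightarrow> real)) set \<Rightarrow> ((real \<Rightarrow> real) \<Rightarrow> real \<Rightarrow> real) \<Rightarrow>
      nat \<Rightarrow> ((real \<Rightarrow> real) \<times> (real \<Rightarrow> real)) set"
  where
    "L1inv_L3_power q A B 0 =
       {(v, B (L1 q v)) | v. v \<in> smooth_circle \<and> L1 q v \<in> L3 q ` smooth_circle}"
  | "L1inv_L3_power q A B (Suc k) = L1inv_L3 q A ^^ k"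

definition L_odd ::
    "(real \<Rightarrow> real) \<Rightarrow> ((real \<Rightarrow> real) \<times> (real \<Rightarrow> real)) set \<Rightarrow> ((real \<Rightarrow> real) \<Rightarrow> real \<Rightarrow> real) \<Rightarrow>
      nat \<Rightarrow> ((real \<Rightarrow> real) \<times> (real \<Rightarrow> real)) set"
  where "L_odd q A B j =
    {(v, L3 q w) | v w. v \<in> smooth_circle \<and> (v, w) \<in> L1inv_L3_power q A B j}"

definition J_odd ::
    "(real \<Rightarrow> real) \<Rightarrow> ((real \<Rightarrow> real) \<times> (real \<Rightarrow> real)) set \<Rightarrow> ((real \<Rightarrow> real) \<Rightarrow> real \<Rightarrow> real) \<Rightarrow>
      nat \<Rightarrow> ((real \<Rightarrow> real) \<times> (real \<Rightarrow> real)) set"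
  where "J_odd q A B j =
    {(\<xi>, (\<lambda>x. - (1/4) * w x)) | \<xi> w.
       \<xi> \<in> L3 q ` smooth_circle \<and> (B \<xi>, w) \<in> L1inv_L3_power q A B j}"

definition L_hat ::
    "(real \<Rightarrow> real^2) \<Rightarrow> ((real \<Rightarrow> real) \<times> (real \<Rightarrow> real)) set \<Rightarrow> ((real \<Rightarrow> real) \<Rightarrow> real \<Rightarrow> real) \<Rightarrow>
      nat \<Rightarrow> ((real \<Rightarrow> real^2) \<times> (real \<Rightarrow> real^2)) set"
  where "L_hat \<gamma> A B j =
    {(tilde \<gamma> \<xi>, tilde \<gamma> \<eta>) | \<xi> \<eta>. (\<xi>, \<eta>) \<in> J_odd (Psi \<gamma>) A B j}"

section \<open>Brackets and Hamiltonian vector fields\<close>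

text \<open>\<open>X\<close> is a value at \<open>\<gamma>\<close> of the Hamiltonian vector field of \<open>H \<circ> Psi\<close> for the structure induced by
  \<open>L\<^bsub>2j+1\<^esub>\<close>, where \<open>p\<close> is the value of \<open>L\<^bsub>2j+1\<^esub> (\<nabla>H)\<close> at \<open>q = Psi \<gamma>\<close> to which it is mapped.\<close>

definition induced_hamiltonian ::
    "((real \<Rightarrow> real) \<times> (real \<Rightarrow> real)) set \<Rightarrow> ((real \<Rightarrow> real) \<Rightarrow> real \<Rightarrow> real) \<Rightarrow> nat \<Rightarrow>
      ((real \<Rightarrow> real) \<Rightarrow> real) \<Rightarrow> (real \<Rightarrow> real^2) \<Rightarrow> (real \<Rightarrow> real) \<Rightarrow> (real \<Rightarrow> real^2) \<Rightarrow> bool"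
  where "induced_hamiltonian A B j H \<gamma> p X \<longleftrightarrow>
    (\<exists>g. has_gradient H (Psi \<gamma>) g \<and> (g, p) \<in> L_odd (Psi \<gamma>) A B j) \<and> dPsi \<gamma> X p"

text \<open>The brackets are sets of values, because the operators may be undefined at the given gradient
  or, through \<open>A\<close>, have several values there.\<close>

definition bracket ::
    "((real \<Rightarrow> real) \<times> (real \<Rightarrow> real)) set \<Rightarrow> ((real \<Rightarrow> real) \<Rightarrow> real \<Rightarrow> real) \<Rightarrow> nat \<Rightarrow>
      ((real \<Rightarrow> real) \<Rightarrow> real) \<Rightarrow> ((real \<Rightarrow> real) \<Rightarrow> real) \<Rightarrow> (real \<Rightarrow> real) \<Rightarrow> real set"
  where "bracket A B j F1 F2 q =
    {- circle_integral (\<lambda>x. p x * f2 x) | p f1 f2.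
       has_gradient F1 q f1 \<and> has_gradient F2 q f2 \<and> (f1, p) \<in> L_odd q A B j}"

definition bracket_hat ::
    "((real \<Rightarrow> real) \<times> (real \<Rightarrow> real)) set \<Rightarrow> ((real \<Rightarrow> real) \<Rightarrow> real \<Rightarrow> real) \<Rightarrow> nat \<Rightarrow>
      ((real \<Rightarrow> real^2) \<Rightarrow> real) \<Rightarrow> ((real \<Rightarrow> real^2) \<Rightarrow> real) \<Rightarrow> (real \<Rightarrow> real^2) \<Rightarrow> real set"
  where "bracket_hat A B j G1 G2 \<gamma> =
    {- circle_integral (\<lambda>x. \<eta> x * y2 x) | \<eta> Y1 y2.
       \<eta> \<in> smooth_circle \<and> y2 \<in> smooth_circle \<and>
       has_gradient_M2 G1 \<gamma> Y1 \<and> has_gradient_M2 G2 \<gamma> (tilde \<gamma> y2) \<and>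
       (Y1, tilde \<gamma> \<eta>) \<in> L_hat \<gamma> A B j}"

end

theory Submission
  imports Defs "HOL-Library.Periodic_Fun"
begin

text \<open>
  Everything follows from one computation: the differential of the curvature map \<open>\<Psi>\<close> at \<open>\<gamma>\<close> sends the
  tangent vector given by \<open>\<xi>\<close> to \<open>-2 L\<^sub>3 \<xi>\<close> at \<open>q = \<Psi> \<gamma>\<close> (\<open>Psi_variation\<close>). It comes from
  \<open>q = det (\<gamma>'', \<gamma>')\<close>, the frame equation \<open>\<gamma>'' = q \<gamma>\<close> and the commutation of the parameter derivative
  with the derivatives along the circle (\<open>mixed_partial_derivatives\<close>).

  Since \<open>L\<^sub>3\<close> is skew-adjoint (\<open>L3_skew\<close>), a functional with gradient \<open>g\<close> pulls back to a functional on curves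
  whose gradient is given by \<open>2 L\<^sub>3 g\<close> (\<open>gradient_pullback\<close>). This gradient is unique because each
  tangent vector is the velocity of a curve in \<open>M2\<close> (\<open>tilde_velocity_of_curve\<close>).

  Applying \<open>J = -1/4 (L\<^sub>1\<^sup>-\<^sup>1 L\<^sub>3)\<^bsup>j-1\<^esup> L\<^sub>3\<^sup>-\<^sup>1\<close> to \<open>2 L\<^sub>3 g\<close> gives
  \<open>\<eta> = -1/2 (L\<^sub>1\<^sup>-\<^sup>1 L\<^sub>3)\<^bsup>j-1\<^esup> g\<close>, and the differential of \<open>\<Psi>\<close> maps it to
  \<open>-2 L\<^sub>3 \<eta> = L\<^sub>3 (L\<^sub>1\<^sup>-\<^sup>1 L\<^sub>3)\<^bsup>j-1\<^esup> g\<close>, the Hamiltonian vector field on functions.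
  As the inverses are multivalued or only partially defined, this computation is an
  equivalence between values of relations: \<open>J_odd_imp_L_odd\<close> and \<open>L_odd_imp_J_odd\<close>. The identity of the
  brackets is the same correspondence paired with a second gradient, using skew-adjointness once more:
  \<open>\<oint> \<eta> (2 L\<^sub>3 f) = \<oint> (-2 L\<^sub>3 \<eta>) f\<close>.
\<close>

section \<open>Calculus of smooth maps on open sets\<close>

lemma Ck_on_cong:
  assumes "open S" "\<And>x. x \<in> S \<Longrightarrow> f x = g x"
  shows "Ck_on k S f \<longleftrightarrow> Ck_on k S g"
  using assms(2)
proof (induction k arbitrary: f g)
  case 0
  then show ?case by (auto intro: continuous_on_cong)
next
  case (Suc k)
  have D: "(f has_derivative D) (at x) \<longleftrightarrow> (g has_derivative D) (at x)" if "x \<in> S" for x D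
    using has_derivative_transform_within_open[OF _ assms(1) that, of f D UNIV g]
      has_derivative_transform_within_open[OF _ assms(1) that, of g D UNIV f] Suc.prems by metis
  then have "frechet_derivative f (at x) = frechet_derivative g (at x)" if "x \<in> S" for x
    using that by (simp add: frechet_derivative_def)
  then have "Ck_on k S (\<lambda>x. frechet_derivative f (at x) v)
      \<longleftrightarrow> Ck_on k S (\<lambda>x. frechet_derivative g (at x) v)" for v
    by (intro Suc.IH) simp
  then show ?case
    using D by (auto simp: differentiable_def)
qed

text \<open>\<^const>\<open>Ck_on\<close> speaks about \<^const>\<open>frechet_derivative\<close>, a choice. On an open set any derivative found
  by the rules of calculus agrees with the chosen one, so it can be used in its place.\<close>

lemma Ck_on_SucI:
  assumes "open S" "\<And>x. x \<in> S \<Longrightarrow> (f has_derivative f' x) (at x)"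
    and "\<And>v. Ck_on k S (\<lambda>x. f' x v)"
  shows "Ck_on (Suc k) S f"
proof -
  have "Ck_on k S (\<lambda>x. frechet_derivative f (at x) v)" for v
    using Ck_on_cong[OF assms(1), of "\<lambda>x. frechet_derivative f (at x) v" "\<lambda>x. f' x v" k]
      assms(3) frechet_derivative_at[OF assms(2)] by simp
  then show ?thesis
    using assms(2) by (auto simp: differentiable_def)
qed

lemma Ck_on_SucD:
  assumes "Ck_on (Suc k) S f" "x \<in> S"
  shows "(f has_derivative frechet_derivative f (at x)) (at x)"
  using assms by (simp add: frechet_derivative_works)

lemma Ck_on_Suc_imp:
  assumes "open S" "Ck_on (Suc k) S f"
  shows "Ck_on k S f"
  using assms(2)
proof (induction k arbitrary: f)
  case 0
  then show ?case
    by (auto intro!: continuous_at_imp_continuous_on differentiable_imp_continuous_within)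
next
  case (Suc k)
  then show ?case by simp
qed

lemma Ck_on_const [simp]: "open S \<Longrightarrow> Ck_on k S (\<lambda>x. c)"
  by (induction k arbitrary: c) auto

lemma Ck_on_linear:
  assumes "open S" "bounded_linear f"
  shows "Ck_on k S f"
proof (cases k)
  case 0
  then show ?thesis by (simp add: assms bounded_linear.linear linear_continuous_on)
next
  case (Suc n)
  then show ?thesis
    by (auto intro!: Ck_on_SucI[of S f "\<lambda>x. f"] bounded_linear_imp_has_derivative Ck_on_const assms simp del: Ck_on.simps)
qed

lemma Ck_on_add:
  assumes "open S" "Ck_on k S f" "Ck_on k S g"
  shows "Ck_on k S (\<lambda>x. f x + g x)"
  using assms(2,3)
proof (induction k arbitrary: f g)
  case 0
  then show ?case by (simp add: continuous_on_add)
next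
  case (Suc k)
  show ?case
    by (rule Ck_on_SucI[OF assms(1) has_derivative_add[OF Ck_on_SucD[OF Suc.prems(1)] Ck_on_SucD[OF Suc.prems(2)]]])
      (use Suc in auto)
qed

lemma Ck_on_bilinear:
  assumes "open S" "bounded_bilinear h" "Ck_on k S f" "Ck_on k S g"
  shows "Ck_on k S (\<lambda>x. h (f x) (g x))"
  using assms(3,4)
proof (induction k arbitrary: f g)
  case 0
  then show ?case by (simp add: bounded_bilinear.continuous_on[OF assms(2)])
next
  case (Suc k)
  show ?case
    by (rule Ck_on_SucI[OF assms(1) bounded_bilinear.FDERIV[OF assms(2) Ck_on_SucD[OF Suc.prems(1)] Ck_on_SucD[OF Suc.prems(2)]]])
      (use Suc Ck_on_Suc_imp[OF assms(1) Suc.prems(1)] Ck_on_Suc_imp[OF assms(1) Suc.prems(2)]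
         in \<open>auto intro!: Ck_on_add assms(1)\<close>)
qed

lemma Ck_on_sum:
  assumes "open S" "\<And>i. i \<in> I \<Longrightarrow> Ck_on k S (f i)"
  shows "Ck_on k S (\<lambda>x. \<Sum>i\<in>I. f i x)"
  using assms(2) by (induction I rule: infinite_finite_induct) (auto intro: Ck_on_add simp: assms(1))

text \<open>The chain rule writes the derivative of \<open>f \<circ> g\<close> as the derivative of \<open>f\<close> at \<open>g x\<close> in a direction that
  itself depends on \<open>x\<close>. Expanding that direction in a basis separates the two dependences into products
  of functions of class \<open>C\<^sup>k\<close>; this is why the middle space is Euclidean.\<close>

lemma Ck_on_compose:
  fixes g :: "'a::real_normed_vector \<Rightarrow> 'b::euclidean_space"
  assumes "open S" "open T" "g ` S \<subseteq> T" "Ck_on k T f" "Ck_on k S g"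
  shows "Ck_on k S (\<lambda>x. f (g x))"
  using assms(4,5)
proof (induction k arbitrary: f)
  case 0
  then show ?case using assms(3) by (auto intro: continuous_on_compose2)
next
  case (Suc k)
  define F where "F x = frechet_derivative f (at x)" for x
  define G where "G x = frechet_derivative g (at x)" for x
  have f: "(f has_derivative F (g x)) (at (g x))" if "x \<in> S" for x
    using Ck_on_SucD[OF Suc.prems(1), of "g x"] that assms(3) by (auto simp: F_def)
  have g: "(g has_derivative G x) (at x)" if "x \<in> S" for x
    using Ck_on_SucD[OF Suc.prems(2) that] by (simp add: G_def)
  have eq: "F (g x) (G x v) = (\<Sum>b\<in>Basis. (G x v \<bullet> b) *\<^sub>R F (g x) b)" if "x \<in> S" for x v
  proof -
    have "linear (F (g x))" using f[OF that] has_derivative_linear by blast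
    then show ?thesis
      by (subst euclidean_representation[symmetric, of "G x v"])
        (simp only: linear_sum linear_cmul)
  qed
  have g': "Ck_on k S g" by (rule Ck_on_Suc_imp[OF assms(1) Suc.prems(2)])
  have "Ck_on k S (\<lambda>x. \<Sum>b\<in>Basis. (G x v \<bullet> b) *\<^sub>R F (g x) b)" for v
  proof (intro Ck_on_sum Ck_on_bilinear[OF _ bounded_bilinear_scaleR] assms(1))
    fix b :: 'b
    show "Ck_on k S (\<lambda>x. G x v \<bullet> b)"
      using Suc.prems(2) assms(1)
      by (intro Ck_on_bilinear[OF _ bounded_bilinear_inner]) (auto simp: G_def)
    show "Ck_on k S (\<lambda>x. F (g x) b)"
      using Suc.IH[of "\<lambda>y. F y b"] Suc.prems(1) g' by (auto simp: F_def)
  qed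
  then have "Ck_on k S (\<lambda>x. F (g x) (G x v))" for v
    by (subst Ck_on_cong[OF assms(1) eq]) auto
  then show ?case
    by (intro Ck_on_SucI[OF assms(1) diff_chain_at[OF g f, unfolded o_def]]) auto
qed

lemma smooth_onD: "smooth_on S f \<Longrightarrow> x \<in> S \<Longrightarrow> (f has_derivative frechet_derivative f (at x)) (at x)"
  using Ck_on_SucD[of 0 S f x] by (simp only: smooth_on_def)

lemma smooth_on_frechet: "smooth_on S f \<Longrightarrow> smooth_on S (\<lambda>x. frechet_derivative f (at x) v)"
  unfolding smooth_on_def using Ck_on.simps(2) by blast

lemma smooth_on_imp_continuous_on: "smooth_on S f \<Longrightarrow> continuous_on S f"
  unfolding smooth_on_def using Ck_on.simps(1) by blast

lemma smooth_on_cong: "open S \<Longrightarrow> (\<And>x. x \<in> S \<Longrightarrow> f x = g x) \<Longrightarrow> smooth_on S f \<longleftrightarrow> smooth_on S g"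
  unfolding smooth_on_def using Ck_on_cong by blast

lemma smooth_on_const: "open S \<Longrightarrow> smooth_on S (\<lambda>x. c)"
  by (simp add: smooth_on_def)

lemma smooth_on_linear: "open S \<Longrightarrow> bounded_linear f \<Longrightarrow> smooth_on S f"
  by (simp add: smooth_on_def Ck_on_linear)

lemma smooth_on_add: "open S \<Longrightarrow> smooth_on S f \<Longrightarrow> smooth_on S g \<Longrightarrow> smooth_on S (\<lambda>x. f x + g x)"
  by (simp add: smooth_on_def Ck_on_add)

lemma smooth_on_bilinear:
  "open S \<Longrightarrow> bounded_bilinear h \<Longrightarrow> smooth_on S f \<Longrightarrow> smooth_on S g \<Longrightarrow> smooth_on S (\<lambda>x. h (f x) (g x))"
  by (simp add: smooth_on_def Ck_on_bilinear)

lemmas smooth_on_scaleR = smooth_on_bilinear[OF _ bounded_bilinear_scaleR]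
lemmas smooth_on_mult = smooth_on_bilinear[OF _ bounded_bilinear_mult]

lemma smooth_on_compose:
  fixes g :: "'a::real_normed_vector \<Rightarrow> 'b::euclidean_space"
  assumes "open S" "open T" "smooth_on T f" "smooth_on S g" "g ` S \<subseteq> T"
  shows "smooth_on S (\<lambda>x. f (g x))"
  using assms Ck_on_compose unfolding smooth_on_def by blast

text \<open>The exponent is arbitrary because differentiation lowers it, and the induction has to follow.\<close>

lemma smooth_on_powr: "smooth_on {0<..} (\<lambda>x::real. x powr a)"
  unfolding smooth_on_def
proof
  fix k show "Ck_on k {0<..} (\<lambda>x::real. x powr a)"
  proof (induction k arbitrary: a)
    case 0
    then show ?case by (auto intro!: continuous_intros)
  next
    case (Suc k)
    have "Ck_on k {0<..} (\<lambda>x. v * (a * x powr (a - 1)))" for v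
      by (intro Ck_on_bilinear[OF _ bounded_bilinear_mult] Ck_on_const Suc.IH) auto
    moreover have "((\<lambda>x. x powr a) has_derivative (\<lambda>v. v * (a * x powr (a - 1)))) (at x)"
      if "x \<in> {0<..}" for x
      using has_real_derivative_powr[of x a] that
      by (simp add: has_field_derivative_def mult.commute[of _ "_ * _"])
    ultimately show ?case by (intro Ck_on_SucI) auto
  qed
qed

lemma smooth_on_has_Dx:
  fixes f :: "real \<Rightarrow> 'b::real_normed_vector"
  assumes "smooth_on UNIV f"
  shows "(f has_vector_derivative Dx f x) (at x)"
  using smooth_onD[OF assms, of x] unfolding Dx_def
  by (metis UNIV_I differentiableI vector_derivative_works)

lemma smooth_on_Dx:
  fixes f :: "real \<Rightarrow> 'b::real_normed_vector"
  assumes "smooth_on UNIV f"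
  shows "smooth_on UNIV (Dx f)"
proof -
  have "Dx f x = frechet_derivative f (at x) 1" for x
    using frechet_derivative_at[OF smooth_on_has_Dx[OF assms, unfolded has_vector_derivative_def], of x, symmetric]
    by simp
  then have "Dx f = (\<lambda>x. frechet_derivative f (at x) 1)" by auto
  then show ?thesis using smooth_on_frechet[OF assms, of 1] by simp
qed

lemma Dx_eq: "(f has_vector_derivative d) (at x) \<Longrightarrow> Dx f x = d"
  by (simp add: Dx_def vector_derivative_at)

section \<open>Partial derivatives in the parameter and along the circle\<close>

lemma has_vector_derivative_fst:
  assumes "(u has_derivative D) (at (t, x))"
  shows "((\<lambda>t. u (t, x)) has_vector_derivative D (1, 0)) (at t)"
proof -
  interpret linear D using assms has_derivative_linear by blast
  have "((\<lambda>t. u (t, x)) has_derivative (\<lambda>h. D (h, 0))) (at t)"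
    by (rule has_derivative_compose[where f="\<lambda>t. (t, x)", OF _ assms]) (auto intro!: derivative_eq_intros)
  moreover have "(\<lambda>h. D (h, 0)) = (\<lambda>h. h *\<^sub>R D (1, 0))"
  proof
    show "D (h, 0) = h *\<^sub>R D (1, 0)" for h
      using scaleR[of h "(1, 0)"] by simp
  qed
  ultimately show ?thesis
    unfolding has_vector_derivative_def by metis
qed

lemma has_vector_derivative_snd:
  assumes "(u has_derivative D) (at (t, x))"
  shows "((\<lambda>x. u (t, x)) has_vector_derivative D (0, 1)) (at x)"
proof -
  interpret linear D using assms has_derivative_linear by blast
  have "((\<lambda>x. u (t, x)) has_derivative (\<lambda>h. D (0, h))) (at x)"
    by (rule has_derivative_compose[where f="\<lambda>x. (t, x)", OF _ assms]) (auto intro!: derivative_eq_intros)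
  moreover have "(\<lambda>h. D (0, h)) = (\<lambda>h. h *\<^sub>R D (0, 1))"
  proof
    show "D (0, h) = h *\<^sub>R D (0, 1)" for h
      using scaleR[of h "(0, 1)"] by simp
  qed
  ultimately show ?thesis
    unfolding has_vector_derivative_def by metis
qed

lemma smooth_on_partial_Dx:
  assumes "open I" and c: "smooth_on (I \<times> UNIV) (\<lambda>(t, x). c t x)"
  shows "smooth_on (I \<times> UNIV) (\<lambda>(t, x). Dx (c t) x)"
proof -
  have "Dx (c t) x = frechet_derivative (\<lambda>(t, x). c t x) (at (t, x)) (0, 1)" if "t \<in> I" for t x
    by (rule Dx_eq, rule has_vector_derivative_snd[OF smooth_onD[OF c], unfolded prod.case]) (use that in auto)
  then show ?thesis
    using smooth_on_frechet[OF c, of "(0, 1)"] assms(1)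
    by (subst smooth_on_cong[where g="\<lambda>p. frechet_derivative (\<lambda>(t, x). c t x) (at p) (0, 1)"])
      (auto simp: open_Times)
qed

text \<open>Write \<open>c t y\<close> as its value at a base point \<open>a\<close> plus the integral of
  \<open>\<partial>\<^sub>x c\<close> from \<open>a\<close> to \<open>y\<close>. Differentiating in \<open>t\<close> under the integral expresses the velocity \<open>V\<close> as an
  integral of \<open>\<partial>\<^sub>t \<partial>\<^sub>x c\<close>, and the fundamental theorem of calculus then gives \<open>V' = \<partial>\<^sub>t \<partial>\<^sub>x c\<close>. The
  velocity is prescribed at a single parameter \<open>t\<close>, because that is what a curve through a point supplies.\<close>

lemma mixed_partial_derivatives:
  fixes c :: "real \<Rightarrow> real \<Rightarrow> 'b::banach"
  assumes I: "open I" "convex I" "t \<in> I" and c: "smooth_on (I \<times> UNIV) (\<lambda>(t, x). c t x)"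
    and V: "\<And>x. ((\<lambda>t. c t x) has_vector_derivative V x) (at t)"
  shows "((\<lambda>t. Dx (c t) x) has_vector_derivative Dx V x) (at t)"
proof -
  define w where "w p = frechet_derivative (\<lambda>(t, x). c t x) (at p) (0, 1)" for p
  define z where "z p = frechet_derivative w (at p) (1, 0)" for p
  have w: "smooth_on (I \<times> UNIV) w" unfolding w_def by (rule smooth_on_frechet[OF c])
  have z: "smooth_on (I \<times> UNIV) z" unfolding z_def by (rule smooth_on_frechet[OF w])
  have cx: "(c s has_vector_derivative w (s, x)) (at x)" if "s \<in> I" for s x
    unfolding w_def by (rule has_vector_derivative_snd[OF smooth_onD[OF c], unfolded prod.case]) (use that in auto)
  have wt: "((\<lambda>t. w (t, x)) has_vector_derivative z (s, x)) (at s)" if "s \<in> I" for s x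
    unfolding z_def using that by (intro has_vector_derivative_fst smooth_onD[OF w]) auto
  have zc: "continuous_on (I \<times> UNIV) z" by (rule smooth_on_imp_continuous_on[OF z])
  have wc: "continuous_on (I \<times> UNIV) w" by (rule smooth_on_imp_continuous_on[OF w])
  \<comment> \<open>any base point to the left of \<open>x\<close> will do; \<open>x\<close> must be interior to the interval\<close>
  define a b where "a = x - 1" and "b = x + 1"
  have V_eq: "V y = V a + integral {a..y} (\<lambda>s. z (t, s))" if "y \<in> {a..b}" for y
  proof -
    have "((\<lambda>t. integral (cbox a y) (\<lambda>s. w (t, s))) has_vector_derivative
        integral (cbox a y) (\<lambda>s. z (t, s))) (at t within I)"
    proof (rule leibniz_rule_vector_derivative[where fx = "\<lambda>t s. z (t, s)"])
      show "(\<lambda>s. w (r, s)) integrable_on cbox a y" if "r \<in> I" for r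
        by (intro integrable_continuous continuous_on_compose2[OF wc]) (use that in \<open>auto intro!: continuous_intros\<close>)
      show "continuous_on (I \<times> cbox a y) (\<lambda>(r, s). z (r, s))"
        using continuous_on_subset[OF zc, of "I \<times> cbox a y"] by (auto simp: case_prod_beta')
    qed (auto intro!: has_vector_derivative_at_within wt I)
    then have "((\<lambda>t. integral {a..y} (\<lambda>s. w (t, s))) has_vector_derivative
        integral {a..y} (\<lambda>s. z (t, s))) (at t)"
      unfolding at_within_open[OF I(3,1)] cbox_interval .
    moreover have "integral {a..y} (\<lambda>s. w (r, s)) = c r y - c r a" if "r \<in> I" for r
      using cx[OF that] \<open>y \<in> {a..b}\<close>
      by (intro integral_unique fundamental_theorem_of_calculus) (auto intro: has_vector_derivative_at_within)
    ultimately have "((\<lambda>r. c r y - c r a) has_vector_derivative integral {a..y} (\<lambda>s. z (t, s))) (at t)"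
      by (auto intro: has_vector_derivative_transform_within_open[OF _ I(1,3)])
    moreover have "((\<lambda>r. c r y - c r a) has_vector_derivative V y - V a) (at t)"
      by (intro has_vector_derivative_diff V)
    ultimately show ?thesis
      using vector_derivative_unique_at[of _ "integral {a..y} (\<lambda>s. z (t, s))" t "V y - V a"]
      by (simp add: algebra_simps)
  qed
  have "continuous_on {a..b} (\<lambda>s. z (t, s))"
    by (rule continuous_on_compose2[OF zc]) (use I in \<open>auto intro!: continuous_intros\<close>)
  then have "((\<lambda>y. integral {a..y} (\<lambda>s. z (t, s))) has_vector_derivative z (t, x)) (at x within {a..b})"
    by (rule integral_has_vector_derivative) (auto simp: a_def b_def)
  moreover have "x \<in> interior {a..b}"
    by (simp add: a_def b_def interior_atLeastAtMost_real)
  ultimately have "((\<lambda>y. integral {a..y} (\<lambda>s. z (t, s))) has_vector_derivative z (t, x)) (at x)"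
    by (simp only: at_within_interior)
  then have "((\<lambda>y. V a + integral {a..y} (\<lambda>s. z (t, s))) has_vector_derivative z (t, x)) (at x)"
    using has_vector_derivative_add[OF has_vector_derivative_const] by fastforce
  then have "(V has_vector_derivative z (t, x)) (at x)"
    by (rule has_vector_derivative_transform_within_open[where S="{a<..<b}"])
      (auto simp: a_def b_def intro!: V_eq[unfolded a_def b_def, symmetric])
  then have "Dx V x = z (t, x)" by (rule Dx_eq)
  moreover have "Dx (c s) x = w (s, x)" if "s \<in> I" for s
    by (rule Dx_eq[OF cx[OF that]])
  ultimately show ?thesis
    using has_vector_derivative_transform_within_open[OF wt[OF I(3)] I(1,3)] by simp
qed

section \<open>Analysis on the circle\<close>

lemma smooth_circleD:
  assumes "f \<in> smooth_circle"
  shows "smooth_on UNIV f" "f (x + 2 * pi) = f x" "(f has_vector_derivative Dx f x) (at x)"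
  using assms smooth_on_has_Dx by (auto simp: smooth_circle_def)

lemma smooth_circle_continuous: "f \<in> smooth_circle \<Longrightarrow> continuous_on S f"
  using smooth_on_imp_continuous_on[OF smooth_circleD(1)] continuous_on_subset by blast

lemma smooth_circle_has_real_derivative:
  "f \<in> smooth_circle \<Longrightarrow> (f has_real_derivative Dx f x) (at x)"
  using smooth_circleD(3) has_real_derivative_iff_has_vector_derivative by blast

lemma smooth_circle_Dx:
  assumes "f \<in> smooth_circle"
  shows "Dx f \<in> smooth_circle"
proof -
  have "Dx f (x + 2 * pi) = Dx f x" for x
  proof -
    have "((f \<circ> (\<lambda>x. x + 2 * pi)) has_vector_derivative 1 *\<^sub>R Dx f (x + 2 * pi)) (at x)"
      by (intro vector_diff_chain_at smooth_circleD(3)[OF assms]) (auto intro!: derivative_eq_intros)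
    then have "(f has_vector_derivative Dx f (x + 2 * pi)) (at x)"
      using smooth_circleD(2)[OF assms] by (simp add: o_def)
    then show ?thesis by (metis Dx_eq)
  qed
  then show ?thesis
    using smooth_on_Dx[OF smooth_circleD(1)[OF assms]] by (simp add: smooth_circle_def)
qed

lemma smooth_circle_bilinear:
  "bounded_bilinear h \<Longrightarrow> f \<in> smooth_circle \<Longrightarrow> g \<in> smooth_circle \<Longrightarrow> (\<lambda>x. h (f x) (g x)) \<in> smooth_circle"
  by (simp add: smooth_circle_def smooth_on_bilinear)

lemma smooth_circle_const: "(\<lambda>x. c) \<in> smooth_circle"
  by (simp add: smooth_circle_def smooth_on_const)

lemma smooth_circle_mult:
  fixes f g :: "real \<Rightarrow> real"
  shows "f \<in> smooth_circle \<Longrightarrow> g \<in> smooth_circle \<Longrightarrow> (\<lambda>x. f x * g x) \<in> smooth_circle"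
  by (rule smooth_circle_bilinear[OF bounded_bilinear_mult])

lemma smooth_circle_add: "f \<in> smooth_circle \<Longrightarrow> g \<in> smooth_circle \<Longrightarrow> (\<lambda>x. f x + g x) \<in> smooth_circle"
  by (simp add: smooth_circle_def smooth_on_add)

lemma smooth_circle_diff:
  fixes f g :: "real \<Rightarrow> real"
  assumes "f \<in> smooth_circle" "g \<in> smooth_circle"
  shows "(\<lambda>x. f x - g x) \<in> smooth_circle"
  using smooth_circle_add[OF assms(1) smooth_circle_mult[OF smooth_circle_const assms(2)], of "-1"] by simp

lemmas smooth_circle_intros =
  smooth_circle_Dx smooth_circle_mult smooth_circle_add smooth_circle_diff smooth_circle_const

lemma smooth_circle_fundamental_domain:
  fixes x :: real
  obtains y where "y \<in> {0..2 * pi}" "\<And>f. f \<in> smooth_circle \<Longrightarrow> f y = f x"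
proof
  define n where "n = \<lfloor>x / (2 * pi)\<rfloor>"
  have "of_int n \<le> x / (2 * pi)" "x / (2 * pi) \<le> of_int n + 1"
    unfolding n_def by linarith+
  then show "x - of_int n * (2 * pi) \<in> {0..2 * pi}"
    by (simp add: field_simps)
  fix f :: "real \<Rightarrow> 'a" assume "f \<in> smooth_circle"
  then interpret periodic_fun_simple f "2 * pi"
    by unfold_locales (rule smooth_circleD(2))
  show "f (x - of_int n * (2 * pi)) = f x" by (rule minus_of_int)
qed

lemma smooth_circle_bounded:
  fixes f :: "real \<Rightarrow> real"
  assumes "f \<in> smooth_circle"
  obtains M where "M > 0" "\<And>x. \<bar>f x\<bar> \<le> M"
proof -
  have "bounded (f ` {0..2 * pi})"
    by (intro compact_imp_bounded compact_continuous_image smooth_circle_continuous[OF assms]) simp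
  then obtain M where "M > 0" "\<And>x. x \<in> {0..2 * pi} \<Longrightarrow> \<bar>f x\<bar> \<le> M"
    unfolding bounded_pos by auto
  moreover from this(2) have "\<bar>f x\<bar> \<le> M" for x
  proof -
    obtain y where "y \<in> {0..2 * pi}" "f y = f x"
      using smooth_circle_fundamental_domain[of x] assms by blast
    then show ?thesis using \<open>\<And>x. x \<in> {0..2 * pi} \<Longrightarrow> \<bar>f x\<bar> \<le> M\<close>[of y] by simp
  qed
  ultimately show ?thesis using that by blast
qed

lemma circle_integral_has_integral:
  "f \<in> smooth_circle \<Longrightarrow> (f has_integral circle_integral f) {0..2 * pi}"
  unfolding circle_integral_def
  by (intro integrable_integral integrable_continuous_interval smooth_circle_continuous)

lemma circle_integral_diff:
  assumes "f \<in> smooth_circle" "g \<in> smooth_circle"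
  shows "circle_integral (\<lambda>x. f x - g x) = circle_integral f - circle_integral g"
  unfolding circle_integral_def[of "\<lambda>x. f x - g x"]
  by (intro integral_unique has_integral_diff circle_integral_has_integral assms)

lemma circle_integral_add:
  assumes "f \<in> smooth_circle" "g \<in> smooth_circle"
  shows "circle_integral (\<lambda>x. f x + g x) = circle_integral f + circle_integral g"
  unfolding circle_integral_def[of "\<lambda>x. f x + g x"]
  by (intro integral_unique has_integral_add circle_integral_has_integral assms)

lemma circle_integral_mult: "circle_integral (\<lambda>x. a * f x) = a * circle_integral f"
  by (simp add: circle_integral_def)

text \<open>The boundary values agree by periodicity. Integration by parts enters only in this form.\<close>

lemma circle_integral_Dx:
  assumes "f \<in> smooth_circle"
  shows "circle_integral (Dx f) = 0"
proof -
  have "(Dx f has_integral f (2 * pi) - f 0) {0..2 * pi}"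
    by (rule fundamental_theorem_of_calculus)
      (use smooth_circleD(3)[OF assms] in \<open>auto intro: has_vector_derivative_at_within\<close>)
  then show ?thesis
    using smooth_circleD(2)[OF assms, of 0] by (simp add: circle_integral_def integral_unique)
qed

lemma circle_integral_square_eq_0:
  assumes "f \<in> smooth_circle" "circle_integral (\<lambda>x. f x * f x) = 0"
  shows "f x = 0"
proof -
  obtain y where y: "y \<in> {0..2 * pi}" "\<And>f :: real \<Rightarrow> real. f \<in> smooth_circle \<Longrightarrow> f y = f x"
    by (rule smooth_circle_fundamental_domain[of x]) blast
  have "((\<lambda>x. f x * f x) has_integral 0) (cbox 0 (2 * pi))"
    using circle_integral_has_integral[OF smooth_circle_mult[OF assms(1) assms(1)]] assms(2) by simp
  then have "f y * f y = 0"
    by (rule has_integral_0_cbox_imp_0[rotated 2])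
      (use y(1) pi_gt_zero in \<open>auto simp del: pi_gt_zero intro!: smooth_circle_continuous smooth_circle_mult assms(1)\<close>)
  then show ?thesis using y(2)[OF assms(1)] by simp
qed

text \<open>The fundamental lemma of the calculus of variations: test against the difference of the two functions.
  It gives uniqueness of both kinds of gradients.\<close>

lemma circle_integral_separates:
  assumes "f \<in> smooth_circle" "g \<in> smooth_circle"
    and "\<And>v. v \<in> smooth_circle \<Longrightarrow> circle_integral (\<lambda>x. f x * v x) = circle_integral (\<lambda>x. g x * v x)"
  shows "f = g"
proof
  fix x
  define h where "h x = f x - g x" for x
  have h: "h \<in> smooth_circle" unfolding h_def by (intro smooth_circle_diff assms)
  have "circle_integral (\<lambda>x. h x * h x) = circle_integral (\<lambda>x. f x * h x - g x * h x)"
    by (simp add: h_def algebra_simps)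
  also have "\<dots> = 0"
    using assms(3)[OF h] by (simp add: circle_integral_diff smooth_circle_mult assms(1,2) h)
  finally have "h x = 0" by (rule circle_integral_square_eq_0[OF h])
  then show "f x = g x" by (simp add: h_def)
qed

lemma Dx_cmult:
  fixes f :: "real \<Rightarrow> real"
  assumes "f \<in> smooth_circle"
  shows "Dx (\<lambda>x. a * f x) = (\<lambda>x. a * Dx f x)"
  using smooth_circleD(3)[OF assms] by (auto intro!: Dx_eq has_vector_derivative_mult_right)

section \<open>The operators on circle functions\<close>

lemma Dx_real_eq: "(f has_real_derivative d) (at x) \<Longrightarrow> Dx f x = d"
  by (simp add: Dx_eq has_real_derivative_iff_has_vector_derivative)

lemma L1_cmult: "v \<in> smooth_circle \<Longrightarrow> L1 q (\<lambda>x. a * v x) = (\<lambda>x. a * L1 q v x)"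
  by (simp add: L1_def Dx_cmult)

lemma L3_cmult: "v \<in> smooth_circle \<Longrightarrow> L3 q (\<lambda>x. a * v x) = (\<lambda>x. a * L3 q v x)"
  by (simp add: L3_def Dx_cmult smooth_circle_Dx fun_eq_iff algebra_simps)

lemma L3_smooth_circle:
  assumes "q \<in> smooth_circle" "v \<in> smooth_circle"
  shows "L3 q v \<in> smooth_circle"
  unfolding L3_def by (intro smooth_circle_intros assms)

text \<open>The sum of the integrands \<open>(L\<^sub>3 u) v\<close> and \<open>u L\<^sub>3 v\<close> is the derivative of
  \<open>(u'' v - u' v' + u v'') / 4 - q u v\<close>.\<close>

lemma L3_skew:
  assumes q: "q \<in> smooth_circle" and u: "u \<in> smooth_circle" and v: "v \<in> smooth_circle"
  shows "circle_integral (\<lambda>x. L3 q u x * v x) = - circle_integral (\<lambda>x. u x * L3 q v x)"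
proof -
  define P where "P x = 1/4 * (Dx (Dx u) x * v x - Dx u x * Dx v x + u x * Dx (Dx v) x) - q x * (u x * v x)" for x
  have P: "P \<in> smooth_circle" unfolding P_def by (intro smooth_circle_intros q u v)
  note d = smooth_circle_has_real_derivative
  have "(P has_real_derivative L3 q u x * v x + u x * L3 q v x) (at x)" for x
    unfolding P_def L3_def
    by (rule derivative_eq_intros d q u v smooth_circle_Dx refl)+ (simp add: algebra_simps)
  then have "Dx P = (\<lambda>x. L3 q u x * v x + u x * L3 q v x)"
    by (auto intro!: Dx_real_eq)
  then have "circle_integral (\<lambda>x. L3 q u x * v x + u x * L3 q v x) = 0"
    using circle_integral_Dx[OF P] by simp
  moreover have "circle_integral (\<lambda>x. L3 q u x * v x + u x * L3 q v x)
      = circle_integral (\<lambda>x. L3 q u x * v x) + circle_integral (\<lambda>x. u x * L3 q v x)"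
    by (intro circle_integral_add smooth_circle_mult L3_smooth_circle q u v)
  ultimately show ?thesis by simp
qed

section \<open>Moving frame and curvature of a central affine curve\<close>

definition det2 :: "real^2 \<Rightarrow> real^2 \<Rightarrow> real"
  where "det2 a b = a $ 1 * b $ 2 - a $ 2 * b $ 1"

lemma bounded_bilinear_det2: "bounded_bilinear det2"
  unfolding bilinear_conv_bounded_bilinear[symmetric]
  by (auto simp: bilinear_def linear_iff det2_def algebra_simps)

interpretation det2: bounded_bilinear det2
  by (rule bounded_bilinear_det2)

lemma det2_self [simp]: "det2 a a = 0"
  by (simp add: det2_def)

text \<open>Cramer's rule. For \<open>\<gamma>\<close> in \<^const>\<open>M2\<close> it makes \<open>\<gamma>, \<gamma>'\<close> a frame of the plane in which every vector field
  along \<open>\<gamma>\<close> has explicit coefficients.\<close>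

lemma det2_basis_expansion:
  assumes "det2 a b = 1"
  shows "v = det2 v b *\<^sub>R a + det2 a v *\<^sub>R b"
proof -
  have "v $ 1 * det2 a b = det2 v b * a $ 1 + det2 a v * b $ 1"
    "v $ 2 * det2 a b = det2 v b * a $ 2 + det2 a v * b $ 2"
    by (simp_all add: det2_def algebra_simps)
  then show ?thesis
    using assms by (simp add: vec_eq_iff forall_2)
qed

lemma M2_iff: "\<gamma> \<in> M2 \<longleftrightarrow> \<gamma> \<in> smooth_circle \<and> (\<forall>x. det2 (\<gamma> x) (Dx \<gamma> x) = 1)"
proof -
  have "\<gamma> x \<noteq> 0" if "det2 (\<gamma> x) (Dx \<gamma> x) = 1" for x
    using that by (auto simp: det2.zero_left)
  then show ?thesis
    by (auto simp: M2_def det_2 det2_def)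
qed

text \<open>Differentiating \<open>det (\<gamma>, \<gamma>') = 1\<close> gives \<open>det (\<gamma>, \<gamma>'') = 0\<close>, so \<open>\<gamma>''\<close> is a multiple of \<open>\<gamma>\<close>, and the
  factor is \<open>det (\<gamma>'', \<gamma>')\<close>. This formula replaces the definite description in \<^const>\<open>Psi\<close> and can be
  differentiated along curves in \<^const>\<open>M2\<close>.\<close>

lemma M2_curvature:
  assumes "\<gamma> \<in> M2"
  shows Psi_smooth_circle: "Psi \<gamma> \<in> smooth_circle"
    and Dx_Dx_M2: "Dx (Dx \<gamma>) x = Psi \<gamma> x *\<^sub>R \<gamma> x"
    and Psi_eq: "Psi \<gamma> x = det2 (Dx (Dx \<gamma>) x) (Dx \<gamma> x)"
proof -
  define q where "q x = det2 (Dx (Dx \<gamma>) x) (Dx \<gamma> x)" for x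
  have sc: "\<gamma> \<in> smooth_circle" "Dx \<gamma> \<in> smooth_circle" "Dx (Dx \<gamma>) \<in> smooth_circle"
    and det: "\<And>x. det2 (\<gamma> x) (Dx \<gamma> x) = 1"
    using assms by (auto simp: M2_iff smooth_circle_Dx)
  have "((\<lambda>x. det2 (\<gamma> x) (Dx \<gamma> x)) has_vector_derivative
      det2 (\<gamma> x) (Dx (Dx \<gamma>) x) + det2 (Dx \<gamma> x) (Dx \<gamma> x)) (at x)" for x
    by (intro det2.has_vector_derivative smooth_circleD(3) sc)
  then have "((\<lambda>x. 1) has_vector_derivative det2 (\<gamma> x) (Dx (Dx \<gamma>) x)) (at x)" for x
    by (simp add: det)
  then have "det2 (\<gamma> x) (Dx (Dx \<gamma>) x) = 0" for x
    using vector_derivative_unique_at[OF _ has_vector_derivative_const] by blast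
  then have q: "q \<in> smooth_circle \<and> (\<forall>x. Dx (Dx \<gamma>) x = q x *\<^sub>R \<gamma> x)"
    using det2_basis_expansion[OF det, of "Dx (Dx \<gamma>) x" x for x] smooth_circle_bilinear[OF bounded_bilinear_det2 sc(3,2)]
    by (simp add: q_def[abs_def])
  moreover have "r = q" if "r \<in> smooth_circle \<and> (\<forall>x. Dx (Dx \<gamma>) x = r x *\<^sub>R \<gamma> x)" for r
  proof
    fix x
    have "r x *\<^sub>R \<gamma> x = q x *\<^sub>R \<gamma> x" using that q by metis
    moreover have "\<gamma> x \<noteq> 0" using assms by (simp add: M2_def)
    ultimately show "r x = q x" by simp
  qed
  ultimately have "Psi \<gamma> = q" unfolding Psi_def by (rule the_equality)
  then show "Psi \<gamma> \<in> smooth_circle" "Dx (Dx \<gamma>) x = Psi \<gamma> x *\<^sub>R \<gamma> x"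
    "Psi \<gamma> x = det2 (Dx (Dx \<gamma>) x) (Dx \<gamma> x)"
    using q by (simp_all add: q_def)
qed

text \<open>The determinant with \<open>\<gamma>\<close> recovers \<open>\<xi>\<close> from the tangent vector.\<close>

lemma tilde_inject:
  assumes "\<gamma> \<in> M2" "tilde \<gamma> \<xi> = tilde \<gamma> \<eta>"
  shows "\<xi> = \<eta>"
proof
  fix x
  have "det2 (\<gamma> x) (tilde \<gamma> \<xi> x) = \<xi> x" for \<xi>
    using assms(1) by (simp add: tilde_def det2.add_right det2.diff_right det2.scaleR_right M2_iff)
  then show "\<xi> x = \<eta> x" using assms(2) by metis
qed

text \<open>The frame equations \<open>(\<gamma>)' = \<gamma>'\<close>, \<open>(\<gamma>')' = q \<gamma>\<close> in terms of coefficients.\<close>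

lemma Dx_frame:
  assumes "\<gamma> \<in> M2" "a \<in> smooth_circle" "b \<in> smooth_circle"
  shows "Dx (\<lambda>x. a x *\<^sub>R \<gamma> x + b x *\<^sub>R Dx \<gamma> x) =
    (\<lambda>x. (Dx a x + Psi \<gamma> x * b x) *\<^sub>R \<gamma> x + (a x + Dx b x) *\<^sub>R Dx \<gamma> x)"
proof
  fix x
  have "\<gamma> \<in> smooth_circle" using assms(1) by (simp add: M2_iff)
  then have "((\<lambda>x. a x *\<^sub>R \<gamma> x + b x *\<^sub>R Dx \<gamma> x) has_vector_derivative
      (a x *\<^sub>R Dx \<gamma> x + Dx a x *\<^sub>R \<gamma> x) + (b x *\<^sub>R Dx (Dx \<gamma>) x + Dx b x *\<^sub>R Dx \<gamma> x)) (at x)"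
    using assms(2,3)
    by (intro has_vector_derivative_add bounded_bilinear.has_vector_derivative[OF bounded_bilinear_scaleR]
        smooth_circleD(3) smooth_circle_Dx)
  then show "Dx (\<lambda>x. a x *\<^sub>R \<gamma> x + b x *\<^sub>R Dx \<gamma> x) x =
      (Dx a x + Psi \<gamma> x * b x) *\<^sub>R \<gamma> x + (a x + Dx b x) *\<^sub>R Dx \<gamma> x"
    by (auto intro!: Dx_eq simp: Dx_Dx_M2[OF assms(1)] algebra_simps)
qed

lemma tilde_derivatives:
  assumes \<gamma>: "\<gamma> \<in> M2" and \<xi>: "\<xi> \<in> smooth_circle" and q: "q = Psi \<gamma>"
  shows Dx_tilde: "Dx (tilde \<gamma> \<xi>) =
      (\<lambda>x. (- (1/2) * Dx (Dx \<xi>) x + q x * \<xi> x) *\<^sub>R \<gamma> x + (1/2 * Dx \<xi> x) *\<^sub>R Dx \<gamma> x)"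
    and Dx_Dx_tilde: "Dx (Dx (tilde \<gamma> \<xi>)) =
      (\<lambda>x. (- (1/2) * Dx (Dx (Dx \<xi>)) x + 3/2 * q x * Dx \<xi> x + Dx q x * \<xi> x) *\<^sub>R \<gamma> x
        + (q x * \<xi> x) *\<^sub>R Dx \<gamma> x)"
proof -
  have q': "q \<in> smooth_circle" using Psi_smooth_circle[OF \<gamma>] by (simp add: q)
  have d: "Dx (\<lambda>x. - (1/2) * Dx (Dx \<xi>) x + q x * \<xi> x)
      = (\<lambda>x. - (1/2) * Dx (Dx (Dx \<xi>)) x + (Dx q x * \<xi> x + Dx \<xi> x * q x))"
    by (intro ext Dx_real_eq DERIV_add DERIV_cmult DERIV_mult smooth_circle_has_real_derivative smooth_circle_Dx q' \<xi>)
  have \<xi>': "(\<lambda>x. c * Dx \<xi> x) \<in> smooth_circle" "(\<lambda>x. - (1/2) * Dx (Dx \<xi>) x + q x * \<xi> x) \<in> smooth_circle" for c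
    by (intro smooth_circle_intros q' \<xi>)+
  show D: "Dx (tilde \<gamma> \<xi>) =
      (\<lambda>x. (- (1/2) * Dx (Dx \<xi>) x + q x * \<xi> x) *\<^sub>R \<gamma> x + (1/2 * Dx \<xi> x) *\<^sub>R Dx \<gamma> x)"
    unfolding tilde_def
    by (subst Dx_frame[OF \<gamma> \<xi>'(1) \<xi>], subst Dx_cmult[OF smooth_circle_Dx[OF \<xi>]]) (simp add: q)
  show "Dx (Dx (tilde \<gamma> \<xi>)) =
      (\<lambda>x. (- (1/2) * Dx (Dx (Dx \<xi>)) x + 3/2 * q x * Dx \<xi> x + Dx q x * \<xi> x) *\<^sub>R \<gamma> x
        + (q x * \<xi> x) *\<^sub>R Dx \<gamma> x)"
    unfolding D
    unfolding Dx_frame[OF \<gamma> \<xi>'(2) \<xi>'(1)] Dx_cmult[OF smooth_circle_Dx[OF \<xi>]] d q[symmetric]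
  proof
    fix x
    have "- (1/2) * Dx (Dx (Dx \<xi>)) x + (Dx q x * \<xi> x + Dx \<xi> x * q x) + q x * (1/2 * Dx \<xi> x)
        = - (1/2) * Dx (Dx (Dx \<xi>)) x + 3/2 * q x * Dx \<xi> x + Dx q x * \<xi> x"
      and "- (1/2) * Dx (Dx \<xi>) x + q x * \<xi> x + 1/2 * Dx (Dx \<xi>) x = q x * \<xi> x"
      by simp_all
    then show "(- (1/2) * Dx (Dx (Dx \<xi>)) x + (Dx q x * \<xi> x + Dx \<xi> x * q x) + q x * (1/2 * Dx \<xi> x)) *\<^sub>R \<gamma> x
        + (- (1/2) * Dx (Dx \<xi>) x + q x * \<xi> x + 1/2 * Dx (Dx \<xi>) x) *\<^sub>R Dx \<gamma> x
      = (- (1/2) * Dx (Dx (Dx \<xi>)) x + 3/2 * q x * Dx \<xi> x + Dx q x * \<xi> x) *\<^sub>R \<gamma> x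
        + (q x * \<xi> x) *\<^sub>R Dx \<gamma> x"
      by (simp only:)
  qed
qed

section \<open>Tangent vectors and the differential of the curvature map\<close>

lemma smooth_on_slice:
  fixes c :: "real \<Rightarrow> real \<Rightarrow> 'b::real_normed_vector"
  assumes "smooth_on (I \<times> UNIV) (\<lambda>(t, x). c t x)" "open I" "t \<in> I"
  shows "smooth_on UNIV (c t)"
proof -
  have slice: "smooth_on UNIV (\<lambda>x::real. (t, 0) + (0, x))"
    by (intro smooth_on_add smooth_on_const smooth_on_linear bounded_linear_intros) auto
  have "smooth_on UNIV (\<lambda>x. (\<lambda>(t, x). c t x) ((t, 0) + (0, x)))"
    by (rule smooth_on_compose[OF _ _ assms(1) slice]) (use assms in \<open>auto simp: open_Times\<close>)
  then show ?thesis by simp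
qed

text \<open>Every \<open>\<xi>\<close> is realised by a curve, so that the condition on all curves in the definition of a
  gradient on \<^const>\<open>M2\<close> determines the gradient. Moving the points of the circle by \<open>\<phi>\<^sub>t x = x + t \<xi> x\<close> multiplies
  \<open>det (\<gamma>, \<gamma>')\<close> by \<open>\<phi>\<^sub>t'\<close>, which is undone by rescaling the curve by \<open>\<phi>\<^sub>t'\<^bsup>-1/2\<^esup>\<close>. Differentiating the
  rescaling factor at \<open>t = 0\<close> produces the term \<open>-\<xi>'/2\<close> of the tangent vector.\<close>

lemma tilde_velocity_of_curve:
  assumes \<gamma>: "\<gamma> \<in> M2" and \<xi>: "\<xi> \<in> smooth_circle"
  obtains c where "curve_through M2 c \<gamma> (tilde \<gamma> \<xi>)"
proof -
  have \<gamma>': "\<gamma> \<in> smooth_circle" and det: "det2 (\<gamma> x) (Dx \<gamma> x) = 1" for x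
    using \<gamma> by (auto simp: M2_iff)
  note \<xi>' = smooth_circle_Dx[OF \<xi>]
  obtain M where M: "M > 0" "\<And>x. \<bar>Dx \<xi> x\<bar> \<le> M"
    using smooth_circle_bounded[OF \<xi>'] by blast
  \<comment> \<open>on this interval \<open>\<phi>\<^sub>t\<close> has positive derivative, \<open>M\<close> being a bound for \<open>\<xi>'\<close>\<close>
  define I where "I = {- (1 / M)<..<1 / M}"
  define a where "a t x = (1 + t * Dx \<xi> x) powr (- (1/2))" for t x
  define c where "c t x = a t x *\<^sub>R \<gamma> (x + t * \<xi> x)" for t x
  have open_S: "open (I \<times> (UNIV :: real set))" by (simp add: I_def open_Times)
  have pos: "1 + t * Dx \<xi> x > 0" if "t \<in> I" for t x
  proof -
    have "\<bar>t * Dx \<xi> x\<bar> \<le> \<bar>t\<bar> * M" using M(2) by (simp add: abs_mult mult_left_mono)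
    also have "\<dots> < 1" using that M(1) by (auto simp: I_def field_simps abs_less_iff)
    finally show ?thesis by linarith
  qed
  have sm: "smooth_on (I \<times> UNIV) (fst :: real \<times> real \<Rightarrow> real)" "smooth_on (I \<times> UNIV) (snd :: real \<times> real \<Rightarrow> real)"
    by (intro smooth_on_linear open_S bounded_linear_intros)+
  have sm_snd: "smooth_on (I \<times> UNIV) (\<lambda>p. f (snd p))" if "f \<in> smooth_circle" for f :: "real \<Rightarrow> real"
    by (rule smooth_on_compose[OF open_S _ smooth_circleD(1)[OF that] sm(2)]) auto
  have sm_a: "smooth_on (I \<times> UNIV) (\<lambda>(t, x). a t x)"
    unfolding a_def case_prod_beta'
    by (rule smooth_on_compose[OF open_S _ smooth_on_powr smooth_on_add[OF open_S smooth_on_const smooth_on_mult]])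
      (use pos in \<open>auto intro!: open_S sm sm_snd \<xi>'\<close>)
  have sm_c: "smooth_on (I \<times> UNIV) (\<lambda>(t, x). c t x)"
    unfolding c_def case_prod_beta'
    by (intro smooth_on_scaleR open_S sm_a[unfolded case_prod_beta'] smooth_on_compose[OF open_S _ smooth_circleD(1)[OF \<gamma>']]
        smooth_on_add smooth_on_mult sm sm_snd \<xi>) auto
  have c_M2: "c t \<in> M2" if "t \<in> I" for t
  proof -
    have "c t (x + 2 * pi) = c t x" for x
      using smooth_circleD(2)[OF \<xi>] smooth_circleD(2)[OF \<xi>'] smooth_circleD(2)[OF \<gamma>', of "x + t * \<xi> x"]
      by (simp add: c_def a_def algebra_simps)
    then have "c t \<in> smooth_circle"
      using smooth_on_slice[OF sm_c _ that] by (simp add: smooth_circle_def I_def)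
    moreover have "det2 (c t x) (Dx (c t) x) = 1" for x
    proof -
      let ?r = "1 + t * Dx \<xi> x" and ?y = "x + t * \<xi> x"
      have a': "(a t has_vector_derivative Dx (a t) x) (at x)"
        by (rule smooth_on_has_Dx[OF smooth_on_slice[OF sm_a _ that]]) (simp add: I_def)
      have "((\<lambda>x. x + t * \<xi> x) has_vector_derivative ?r) (at x)"
        by (intro has_vector_derivative_add has_vector_derivative_mult_right smooth_circleD(3)[OF \<xi>] has_vector_derivative_id)
      then have "((\<gamma> \<circ> (\<lambda>x. x + t * \<xi> x)) has_vector_derivative ?r *\<^sub>R Dx \<gamma> ?y) (at x)"
        by (intro vector_diff_chain_at smooth_circleD(3)[OF \<gamma>'])
      then have "(c t has_vector_derivative a t x *\<^sub>R ?r *\<^sub>R Dx \<gamma> ?y + Dx (a t) x *\<^sub>R \<gamma> ?y) (at x)"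
        unfolding c_def by (intro bounded_bilinear.has_vector_derivative[OF bounded_bilinear_scaleR] a') (simp add: o_def)
      then have "det2 (c t x) (Dx (c t) x) = a t x * a t x * ?r * det2 (\<gamma> ?y) (Dx \<gamma> ?y)"
        by (simp add: Dx_eq c_def det2.add_right det2.scaleR_left det2.scaleR_right)
      also have "a t x * a t x * ?r = 1"
        using pos[OF that, of x] by (simp add: a_def powr_minus divide_simps flip: powr_add)
      finally show ?thesis by (simp add: det)
    qed
    ultimately show ?thesis by (simp add: M2_iff)
  qed
  have "((\<lambda>t. c t x) has_vector_derivative tilde \<gamma> \<xi> x) (at 0)" for x
  proof -
    have "((\<lambda>t. a t x) has_vector_derivative - (1/2) * Dx \<xi> x) (at 0)"
      unfolding a_def has_real_derivative_iff_has_vector_derivative[symmetric]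
      by (auto intro!: derivative_eq_intros)
    moreover have "((\<gamma> \<circ> (\<lambda>t. x + t * \<xi> x)) has_vector_derivative \<xi> x *\<^sub>R Dx \<gamma> x) (at 0)"
      using smooth_circleD(3)[OF \<gamma>', of x]
      by (intro vector_diff_chain_at) (auto intro!: derivative_eq_intros)
    ultimately have "((\<lambda>t. c t x) has_vector_derivative
        a 0 x *\<^sub>R \<xi> x *\<^sub>R Dx \<gamma> x + (- (1/2) * Dx \<xi> x) *\<^sub>R \<gamma> (x + 0 * \<xi> x)) (at 0)"
      unfolding c_def o_def by (intro bounded_bilinear.has_vector_derivative[OF bounded_bilinear_scaleR])
    then show ?thesis
      by (simp add: tilde_def a_def add.commute)
  qed
  moreover have "c 0 = \<gamma>" by (auto simp: c_def a_def)
  ultimately have "curve_through M2 c \<gamma> (tilde \<gamma> \<xi>)"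
    unfolding curve_through_def using sm_c c_M2 M(1) by (auto simp: I_def intro!: exI[of _ "1 / M"])
  then show ?thesis using that by blast
qed

text \<open>The velocity of \<open>q = det (\<gamma>'', \<gamma>')\<close> is
  \<open>det (\<gamma>'', V') + det (V'', \<gamma>')\<close>, where \<open>V = -\<xi>'/2 \<gamma> + \<xi> \<gamma>'\<close>; here the \<open>x\<close>-derivatives of the velocity are the
  velocities of the \<open>x\<close>-derivatives. In the frame the two terms are \<open>q \<xi>'/2\<close> and
  \<open>-\<xi>'''/2 + 3/2 q \<xi>' + q' \<xi>\<close>.\<close>

lemma Psi_variation:
  assumes \<gamma>: "\<gamma> \<in> M2" and \<xi>: "\<xi> \<in> smooth_circle" and c: "curve_through M2 c \<gamma> (tilde \<gamma> \<xi>)"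
  shows "curve_through smooth_circle (\<lambda>t. Psi (c t)) (Psi \<gamma>) (\<lambda>x. - 2 * L3 (Psi \<gamma>) \<xi> x)"
proof -
  from c obtain \<epsilon> where \<epsilon>: "\<epsilon> > 0" and sm: "smooth_on ({-\<epsilon><..<\<epsilon>} \<times> UNIV) (\<lambda>(t, x). c t x)"
    and M: "\<And>t. t \<in> {-\<epsilon><..<\<epsilon>} \<Longrightarrow> c t \<in> M2" and c0: "c 0 = \<gamma>"
    and vel: "\<And>x. ((\<lambda>t. c t x) has_vector_derivative tilde \<gamma> \<xi> x) (at 0)"
    unfolding curve_through_def by blast
  define I where "I = {-\<epsilon><..<\<epsilon>}"
  have I: "open I" "convex I" "0 \<in> I" using \<epsilon> by (auto simp: I_def)
  note sm = sm[folded I_def] and M = M[folded I_def]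
  note sm1 = smooth_on_partial_Dx[OF I(1) sm]
  note sm2 = smooth_on_partial_Dx[OF I(1) sm1]
  have Psi: "Psi (c t) x = det2 (Dx (Dx (c t)) x) (Dx (c t) x)" if "t \<in> I" for t x
    by (rule Psi_eq[OF M[OF that]])
  have sc: "Psi (c t) \<in> smooth_circle" if "t \<in> I" for t
    by (rule Psi_smooth_circle[OF M[OF that]])
  have "smooth_on (I \<times> UNIV) (\<lambda>(t, x). det2 (Dx (Dx (c t)) x) (Dx (c t) x))"
    using smooth_on_bilinear[OF _ bounded_bilinear_det2 sm2 sm1] I(1)
    by (simp add: case_prod_beta' open_Times)
  then have smPsi: "smooth_on (I \<times> UNIV) (\<lambda>(t, x). Psi (c t) x)"
    using I(1) by (subst smooth_on_cong[where g="\<lambda>(t, x). det2 (Dx (Dx (c t)) x) (Dx (c t) x)"])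
      (auto simp: open_Times Psi)
  have vel1: "((\<lambda>t. Dx (c t) x) has_vector_derivative Dx (tilde \<gamma> \<xi>) x) (at 0)" for x
    by (rule mixed_partial_derivatives[OF I sm vel])
  have vel2: "((\<lambda>t. Dx (Dx (c t)) x) has_vector_derivative Dx (Dx (tilde \<gamma> \<xi>)) x) (at 0)" for x
    by (rule mixed_partial_derivatives[OF I sm1 vel1])
  have velPsi: "((\<lambda>t. Psi (c t) x) has_vector_derivative - 2 * L3 (Psi \<gamma>) \<xi> x) (at 0)" for x
  proof -
    have det: "det2 (\<gamma> x) (Dx \<gamma> x) = 1" using \<gamma> by (simp add: M2_iff)
    have "((\<lambda>t. det2 (Dx (Dx (c t)) x) (Dx (c t) x)) has_vector_derivative
        det2 (Dx (Dx (c 0)) x) (Dx (tilde \<gamma> \<xi>) x) + det2 (Dx (Dx (tilde \<gamma> \<xi>)) x) (Dx (c 0) x)) (at 0)"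
      by (intro det2.has_vector_derivative vel1 vel2)
    also have "det2 (Dx (Dx (c 0)) x) (Dx (tilde \<gamma> \<xi>) x) + det2 (Dx (Dx (tilde \<gamma> \<xi>)) x) (Dx (c 0) x)
        = - 2 * L3 (Psi \<gamma>) \<xi> x"
      \<comment> \<open>the second derivative is rewritten first because it contains the first one as a subterm\<close>
      unfolding c0 Dx_Dx_M2[OF \<gamma>] Dx_Dx_tilde[OF \<gamma> \<xi> refl] unfolding Dx_tilde[OF \<gamma> \<xi> refl]
      unfolding det2.add_left det2.add_right det2.scaleR_left det2.scaleR_right det det2_self
      by (simp add: L3_def algebra_simps)
    finally show ?thesis
      by (rule has_vector_derivative_transform_within_open[OF _ I(1,3)]) (simp add: Psi)
  qed
  show ?thesis
    unfolding curve_through_def using \<epsilon> smPsi sc c0 velPsi by (auto simp: I_def)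
qed

lemma dPsi_tilde:
  assumes "\<gamma> \<in> M2" "\<xi> \<in> smooth_circle"
  shows "dPsi \<gamma> (tilde \<gamma> \<xi>) (\<lambda>x. - 2 * L3 (Psi \<gamma>) \<xi> x)"
  unfolding dPsi_def using tilde_velocity_of_curve[OF assms] Psi_variation[OF assms] by metis

section \<open>Gradients\<close>

text \<open>The straight lines \<open>q + t v\<close> realise every direction.\<close>

lemma has_gradient_unique:
  assumes "q \<in> smooth_circle" "has_gradient F q f" "has_gradient F q g"
  shows "f = g"
proof (rule circle_integral_separates)
  show sc: "f \<in> smooth_circle" "g \<in> smooth_circle"
    using assms(2,3) by (auto simp: has_gradient_def)
  fix v :: "real \<Rightarrow> real" assume v: "v \<in> smooth_circle"
  have open_S: "open ({-1<..<1::real} \<times> (UNIV :: real set))" by (simp add: open_Times)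
  have fs: "smooth_on ({-1<..<1::real} \<times> (UNIV :: real set)) (fst :: real \<times> real \<Rightarrow> real)" "smooth_on ({-1<..<1::real} \<times> (UNIV :: real set)) (snd :: real \<times> real \<Rightarrow> real)"
    by (intro smooth_on_linear open_S bounded_linear_intros)+
  have fsnd: "smooth_on ({-1<..<1::real} \<times> (UNIV :: real set)) (\<lambda>p. h (snd p))" if "h \<in> smooth_circle" for h :: "real \<Rightarrow> real"
    by (rule smooth_on_compose[OF open_S _ smooth_circleD(1)[OF that] fs(2)]) auto
  have "smooth_on ({-1<..<1::real} \<times> (UNIV :: real set)) (\<lambda>(t, x). q x + t * v x)"
    unfolding case_prod_beta' by (rule smooth_on_add[OF open_S fsnd[OF assms(1)] smooth_on_mult[OF open_S fs(1) fsnd[OF v]]])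
  moreover have "((\<lambda>t. q x + t * v x) has_vector_derivative v x) (at 0)" for x
    unfolding has_real_derivative_iff_has_vector_derivative[symmetric]
    by (auto intro!: derivative_eq_intros)
  moreover have "(\<lambda>x. q x + t * v x) \<in> smooth_circle" for t
    by (rule smooth_circle_add[OF assms(1) smooth_circle_mult[OF smooth_circle_const v]])
  ultimately have "curve_through smooth_circle (\<lambda>t x. q x + t * v x) q v"
    unfolding curve_through_def by (intro conjI exI[of _ 1]) simp_all
  then have "((\<lambda>t. F (\<lambda>x. q x + t * v x)) has_real_derivative circle_integral (\<lambda>x. f x * v x)) (at 0)"
    and "((\<lambda>t. F (\<lambda>x. q x + t * v x)) has_real_derivative circle_integral (\<lambda>x. g x * v x)) (at 0)"
    using assms(2,3) unfolding has_gradient_def by blast+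
  then show "circle_integral (\<lambda>x. f x * v x) = circle_integral (\<lambda>x. g x * v x)"
    by (rule DERIV_unique)
qed

lemma has_gradient_M2_unique:
  assumes \<gamma>: "\<gamma> \<in> M2" and Y: "has_gradient_M2 G \<gamma> Y" and Z: "has_gradient_M2 G \<gamma> Z"
  shows "Y = Z"
proof -
  obtain y where y: "y \<in> smooth_circle" "Y = tilde \<gamma> y"
    "\<And>c \<xi>. \<xi> \<in> smooth_circle \<Longrightarrow> curve_through M2 c \<gamma> (tilde \<gamma> \<xi>) \<Longrightarrow>
       ((\<lambda>t. G (c t)) has_real_derivative circle_integral (\<lambda>x. y x * \<xi> x)) (at 0)"
    using Y unfolding has_gradient_M2_def by blast
  obtain z where z: "z \<in> smooth_circle" "Z = tilde \<gamma> z"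
    "\<And>c \<xi>. \<xi> \<in> smooth_circle \<Longrightarrow> curve_through M2 c \<gamma> (tilde \<gamma> \<xi>) \<Longrightarrow>
       ((\<lambda>t. G (c t)) has_real_derivative circle_integral (\<lambda>x. z x * \<xi> x)) (at 0)"
    using Z unfolding has_gradient_M2_def by blast
  have "y = z"
  proof (rule circle_integral_separates[OF y(1) z(1)])
    fix \<xi> :: "real \<Rightarrow> real" assume \<xi>: "\<xi> \<in> smooth_circle"
    obtain c where "curve_through M2 c \<gamma> (tilde \<gamma> \<xi>)"
      by (rule tilde_velocity_of_curve[OF \<gamma> \<xi>])
    then show "circle_integral (\<lambda>x. y x * \<xi> x) = circle_integral (\<lambda>x. z x * \<xi> x)"
      using y(3)[OF \<xi>] z(3)[OF \<xi>] DERIV_unique by blast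
  qed
  then show ?thesis by (simp add: y(2) z(2))
qed

text \<open>Chain rule and skew-adjointness:
  \<open>\<oint> f (-2 L\<^sub>3 \<xi>) = \<oint> (2 L\<^sub>3 f) \<xi>\<close>.\<close>

lemma gradient_pullback:
  assumes \<gamma>: "\<gamma> \<in> M2" and f: "has_gradient F (Psi \<gamma>) f"
  shows "has_gradient_M2 (F \<circ> Psi) \<gamma> Y \<longleftrightarrow> Y = tilde \<gamma> (\<lambda>x. 2 * L3 (Psi \<gamma>) f x)"
proof -
  let ?q = "Psi \<gamma>"
  have q: "?q \<in> smooth_circle" and f': "f \<in> smooth_circle"
    using Psi_smooth_circle[OF \<gamma>] f by (auto simp: has_gradient_def)
  have "((\<lambda>t. (F \<circ> Psi) (c t)) has_real_derivative circle_integral (\<lambda>x. 2 * L3 ?q f x * \<xi> x)) (at 0)"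
    if \<xi>: "\<xi> \<in> smooth_circle" and c: "curve_through M2 c \<gamma> (tilde \<gamma> \<xi>)" for c \<xi>
  proof -
    have "((\<lambda>t. F (Psi (c t))) has_real_derivative circle_integral (\<lambda>x. f x * (- 2 * L3 ?q \<xi> x))) (at 0)"
      using f Psi_variation[OF \<gamma> \<xi> c] unfolding has_gradient_def by blast
    moreover have "circle_integral (\<lambda>x. f x * (- 2 * L3 ?q \<xi> x)) = circle_integral (\<lambda>x. 2 * L3 ?q f x * \<xi> x)"
      using L3_skew[OF q f' \<xi>] circle_integral_mult[of "-2" "\<lambda>x. f x * L3 ?q \<xi> x"]
        circle_integral_mult[of 2 "\<lambda>x. L3 ?q f x * \<xi> x"]
      by (simp add: mult.left_commute mult.assoc)
    ultimately show ?thesis by simp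
  qed
  moreover have "(\<lambda>x. 2 * L3 ?q f x) \<in> smooth_circle"
    by (intro smooth_circle_intros L3_smooth_circle q f')
  ultimately have "has_gradient_M2 (F \<circ> Psi) \<gamma> (tilde \<gamma> (\<lambda>x. 2 * L3 ?q f x))"
    unfolding has_gradient_M2_def by blast
  then show ?thesis using has_gradient_M2_unique[OF \<gamma>] by blast
qed

section \<open>The operator identity\<close>

lemma L1inv_L3_smooth_circle:
  assumes "formal_inverse_L1 q A" "(v, w) \<in> L1inv_L3 q A"
  shows "w \<in> smooth_circle"
  using assms unfolding formal_inverse_L1_def L1inv_L3_def by blast

lemma L1inv_L3_cmult:
  assumes A: "formal_inverse_L1 q A" and vw: "(v, w) \<in> L1inv_L3 q A"
  shows "((\<lambda>x. a * v x), (\<lambda>x. a * w x)) \<in> L1inv_L3 q A"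
proof -
  have v: "v \<in> smooth_circle" "(L3 q v, w) \<in> A" using vw by (auto simp: L1inv_L3_def)
  then have "((\<lambda>x. a * L3 q v x + 0 * L3 q v x), (\<lambda>x. a * w x + 0 * w x)) \<in> A"
    using A unfolding formal_inverse_L1_def by blast
  then show ?thesis
    using v by (simp add: L1inv_L3_def L3_cmult smooth_circle_intros)
qed

lemma L1inv_L3_relpow:
  assumes A: "formal_inverse_L1 q A" and "(v, w) \<in> L1inv_L3 q A ^^ k"
  shows L1inv_L3_relpow_smooth_circle: "v \<in> smooth_circle \<Longrightarrow> w \<in> smooth_circle"
    and L1inv_L3_relpow_cmult: "((\<lambda>x. a * v x), (\<lambda>x. a * w x)) \<in> L1inv_L3 q A ^^ k"
  using assms(2)
proof (induction k arbitrary: w)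
  case (Suc k)
  {
    case 1
    then show ?case using L1inv_L3_smooth_circle[OF A] by (blast elim: relpow_Suc_E)
  next
    case 2
    then show ?case using Suc.IH(2) L1inv_L3_cmult[OF A] by (blast elim: relpow_Suc_E intro: relpow_Suc_I)
  }
qed auto

lemma L1inv_L3_power_smooth_circle:
  assumes "formal_inverse_L1 q A" "formal_inverse_L3 q B" "v \<in> smooth_circle" "(v, w) \<in> L1inv_L3_power q A B j"
  shows "w \<in> smooth_circle"
proof (cases j)
  case 0
  then show ?thesis using assms(2,4) by (auto simp: formal_inverse_L3_def)
next
  case (Suc k)
  then show ?thesis using L1inv_L3_relpow_smooth_circle[OF assms(1) _ assms(3)] assms(4) by auto
qed

text \<open>Homogeneity of the powers, seen through \<open>L\<^sub>3\<close>. For positive \<open>j\<close> the value itself scales, by linearity of the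
  inverse of \<open>L\<^sub>1\<close>. For \<open>j = 0\<close> the chosen inverse of \<open>L\<^sub>3\<close> may pick preimages of \<open>u\<close> and \<open>a u\<close> that are not
  proportional, but their images under \<open>L\<^sub>3\<close> are, and only these enter the vector fields.\<close>

lemma L1inv_L3_power_cmult:
  assumes A: "formal_inverse_L1 q A" and B: "formal_inverse_L3 q B" and v: "v \<in> smooth_circle"
    and vw: "(v, w) \<in> L1inv_L3_power q A B j"
  obtains w' where "((\<lambda>x. a * v x), w') \<in> L1inv_L3_power q A B j" "L3 q w' = (\<lambda>x. a * L3 q w x)"
proof (cases j)
  case 0
  then obtain u where w: "w = B (L1 q v)" and u: "u \<in> smooth_circle" "L1 q v = L3 q u"
    using vw by auto
  have "L1 q (\<lambda>x. a * v x) = L3 q (\<lambda>x. a * u x)"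
    using u by (simp add: L1_cmult[OF v] L3_cmult)
  moreover have au: "(\<lambda>x. a * u x) \<in> smooth_circle" and av: "(\<lambda>x. a * v x) \<in> smooth_circle"
    by (intro smooth_circle_intros u v)+
  ultimately have im: "L1 q (\<lambda>x. a * v x) \<in> L3 q ` smooth_circle" by blast
  have "L3 q (B (L1 q (\<lambda>x. a * v x))) = L1 q (\<lambda>x. a * v x)"
    using B im unfolding formal_inverse_L3_def by blast
  also have "\<dots> = (\<lambda>x. a * L1 q v x)"
    by (rule L1_cmult[OF v])
  also have "L1 q v = L3 q w"
    using B u by (simp add: w formal_inverse_L3_def)
  finally show ?thesis
    using that 0 im av by auto
next
  case (Suc k)
  then show ?thesis
    using that[of "\<lambda>x. a * w x"] L1inv_L3_relpow_cmult[OF A] L3_cmult[OF L1inv_L3_power_smooth_circle[OF A B v vw]] vw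
    by auto
qed

text \<open>At the gradient \<open>2 L\<^sub>3 g\<close> the innermost \<open>L\<^sub>3\<^sup>-\<^sup>1\<close> of \<open>J\<close> returns \<open>2 g\<close>, so \<open>\<eta> = -w/4\<close> with \<open>w\<close> a value of
  \<open>(L\<^sub>1\<^sup>-\<^sup>1 L\<^sub>3)\<^bsup>j-1\<^esup>\<close> at \<open>2 g\<close>. Hence \<open>-2 L\<^sub>3 \<eta> = L\<^sub>3 w / 2\<close>, and the factor \<open>1/2\<close> cancels the \<open>2\<close> in the argument.\<close>

lemma J_odd_imp_L_odd:
  assumes A: "formal_inverse_L1 q A" and B: "formal_inverse_L3 q B" and g: "g \<in> smooth_circle"
    and sel: "selects q B (\<lambda>x. 2 * g x)" and J: "((\<lambda>x. 2 * L3 q g x), \<eta>) \<in> J_odd q A B j"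
  shows "\<eta> \<in> smooth_circle" "(g, (\<lambda>x. - 2 * L3 q \<eta> x)) \<in> L_odd q A B j"
proof -
  have g2: "(\<lambda>x. 2 * g x) \<in> smooth_circle" by (intro smooth_circle_intros g)
  obtain w where w: "\<eta> = (\<lambda>x. - (1/4) * w x)" "((\<lambda>x. 2 * g x), w) \<in> L1inv_L3_power q A B j"
    using J sel by (auto simp: J_odd_def selects_def L3_cmult[OF g])
  have w': "w \<in> smooth_circle" by (rule L1inv_L3_power_smooth_circle[OF A B g2 w(2)])
  then show "\<eta> \<in> smooth_circle" unfolding w(1) by (intro smooth_circle_intros)
  obtain u where "((\<lambda>x. 1/2 * (2 * g x)), u) \<in> L1inv_L3_power q A B j" "L3 q u = (\<lambda>x. 1/2 * L3 q w x)"
    by (rule L1inv_L3_power_cmult[OF A B g2 w(2)])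
  moreover have "(\<lambda>x. - 2 * L3 q \<eta> x) = (\<lambda>x. 1/2 * L3 q w x)"
    unfolding w(1) L3_cmult[OF w'] by simp
  ultimately have "(g, u) \<in> L1inv_L3_power q A B j" "(\<lambda>x. - 2 * L3 q \<eta> x) = L3 q u"
    by simp_all
  then show "(g, (\<lambda>x. - 2 * L3 q \<eta> x)) \<in> L_odd q A B j"
    using g unfolding L_odd_def by blast
qed

text \<open>The same rescaling in the other direction, now for an arbitrary admissible value \<open>p\<close>: it shows that \<open>J\<close>
  misses no Hamiltonian vector field and no value of the bracket.\<close>

lemma L_odd_imp_J_odd:
  assumes A: "formal_inverse_L1 q A" and B: "formal_inverse_L3 q B" and g: "g \<in> smooth_circle"
    and sel: "selects q B (\<lambda>x. 2 * g x)" and L: "(g, p) \<in> L_odd q A B j"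
  obtains \<eta> where "((\<lambda>x. 2 * L3 q g x), \<eta>) \<in> J_odd q A B j" "p = (\<lambda>x. - 2 * L3 q \<eta> x)"
proof -
  have g2: "(\<lambda>x. 2 * g x) \<in> smooth_circle" by (intro smooth_circle_intros g)
  obtain w where w: "p = L3 q w" "(g, w) \<in> L1inv_L3_power q A B j"
    using L by (auto simp: L_odd_def)
  obtain u where u: "((\<lambda>x. 2 * g x), u) \<in> L1inv_L3_power q A B j" "L3 q u = (\<lambda>x. 2 * L3 q w x)"
    by (rule L1inv_L3_power_cmult[OF A B g w(2)])
  have u': "u \<in> smooth_circle" by (rule L1inv_L3_power_smooth_circle[OF A B g2 u(1)])
  have "p = (\<lambda>x. - 2 * L3 q (\<lambda>x. - (1/4) * u x) x)"
    unfolding L3_cmult[OF u'] u(2) w(1) by simp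
  moreover have "((\<lambda>x. 2 * L3 q g x), (\<lambda>x. - (1/4) * u x)) \<in> J_odd q A B j"
  proof -
    have "L3 q (\<lambda>x. 2 * g x) \<in> L3 q ` smooth_circle" using g2 by (rule imageI)
    moreover have "(B (L3 q (\<lambda>x. 2 * g x)), u) \<in> L1inv_L3_power q A B j"
      using sel u(1) by (simp only: selects_def)
    ultimately show ?thesis
      unfolding J_odd_def L3_cmult[OF g, symmetric] by blast
  qed
  ultimately show ?thesis using that by blast
qed

lemma L_hat_tilde_iff:
  assumes "\<gamma> \<in> M2"
  shows "(tilde \<gamma> \<xi>, X) \<in> L_hat \<gamma> A B j \<longleftrightarrow> (\<exists>\<eta>. X = tilde \<gamma> \<eta> \<and> (\<xi>, \<eta>) \<in> J_odd (Psi \<gamma>) A B j)"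
  using tilde_inject[OF assms] unfolding L_hat_def by blast

section \<open>The induced Hamiltonian structure\<close>

theorem proposition4p4:
  fixes H :: "(real \<Rightarrow> real) \<Rightarrow> real"
    and \<gamma> :: "real \<Rightarrow> real^2"
    and q g :: "real \<Rightarrow> real"
    and A :: "((real \<Rightarrow> real) \<times> (real \<Rightarrow> real)) set"
    and B :: "(real \<Rightarrow> real) \<Rightarrow> real \<Rightarrow> real"
    and j :: nat
  assumes "\<gamma> \<in> M2"
    and "q = Psi \<gamma>"
    and "has_gradient H q g"
    and "formal_inverse_L1 q A"
    and "formal_inverse_L3 q B"
    and "selects q B (\<lambda>x. 2 * g x)"
  shows "(\<exists>!Y. has_gradient_M2 (H \<circ> Psi) \<gamma> Y) \<and>
    (\<forall>Y. has_gradient_M2 (H \<circ> Psi) \<gamma> Y \<longrightarrow>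
       (\<forall>X. (Y, X) \<in> L_hat \<gamma> A B j \<longrightarrow> (\<exists>p. induced_hamiltonian A B j H \<gamma> p X)) \<and>
       (\<forall>p. (g, p) \<in> L_odd q A B j \<longrightarrow>
          (\<exists>X. (Y, X) \<in> L_hat \<gamma> A B j \<and> induced_hamiltonian A B j H \<gamma> p X))) \<and>
    (\<forall>F. (\<exists>f. has_gradient F q f) \<longrightarrow>
       bracket_hat A B j (H \<circ> Psi) (F \<circ> Psi) \<gamma> = bracket A B j H F q)"
proof -
  note \<gamma> = assms(1) and A = assms(4) and B = assms(5) and sel = assms(6)
  have q: "q \<in> smooth_circle" using Psi_smooth_circle[OF \<gamma>] by (simp add: assms(2))
  have g: "g \<in> smooth_circle" using assms(3) by (simp add: has_gradient_def)
  have grad: "has_gradient_M2 (F \<circ> Psi) \<gamma> Y \<longleftrightarrow> Y = tilde \<gamma> (\<lambda>x. 2 * L3 q f x)"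
    if "has_gradient F q f" for F f Y
    using gradient_pullback[OF \<gamma>] that by (simp add: assms(2))
  note L_hat_iff = L_hat_tilde_iff[OF \<gamma>, folded assms(2)]
  have forward: "\<eta> \<in> smooth_circle" "(g, (\<lambda>x. - 2 * L3 q \<eta> x)) \<in> L_odd q A B j"
      "induced_hamiltonian A B j H \<gamma> (\<lambda>x. - 2 * L3 q \<eta> x) (tilde \<gamma> \<eta>)"
    if "((\<lambda>x. 2 * L3 q g x), \<eta>) \<in> J_odd q A B j" for \<eta>
  proof -
    note * = J_odd_imp_L_odd[OF A B g sel that]
    then show "\<eta> \<in> smooth_circle" "(g, (\<lambda>x. - 2 * L3 q \<eta> x)) \<in> L_odd q A B j" .
    then show "induced_hamiltonian A B j H \<gamma> (\<lambda>x. - 2 * L3 q \<eta> x) (tilde \<gamma> \<eta>)"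
      using dPsi_tilde[OF \<gamma>] assms(3) unfolding induced_hamiltonian_def assms(2) by blast
  qed
  have vector_fields: "(\<forall>X. (Y, X) \<in> L_hat \<gamma> A B j \<longrightarrow> (\<exists>p. induced_hamiltonian A B j H \<gamma> p X)) \<and>
       (\<forall>p. (g, p) \<in> L_odd q A B j \<longrightarrow>
          (\<exists>X. (Y, X) \<in> L_hat \<gamma> A B j \<and> induced_hamiltonian A B j H \<gamma> p X))"
    if "has_gradient_M2 (H \<circ> Psi) \<gamma> Y" for Y
  proof (intro conjI allI impI)
    have Y: "Y = tilde \<gamma> (\<lambda>x. 2 * L3 q g x)" using that grad[OF assms(3)] by blast
    show "\<exists>p. induced_hamiltonian A B j H \<gamma> p X" if "(Y, X) \<in> L_hat \<gamma> A B j" for X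
      using that forward unfolding Y L_hat_iff by blast
    fix p assume "(g, p) \<in> L_odd q A B j"
    then obtain \<eta> where "((\<lambda>x. 2 * L3 q g x), \<eta>) \<in> J_odd q A B j" "p = (\<lambda>x. - 2 * L3 q \<eta> x)"
      by (rule L_odd_imp_J_odd[OF A B g sel])
    then show "\<exists>X. (Y, X) \<in> L_hat \<gamma> A B j \<and> induced_hamiltonian A B j H \<gamma> p X"
      using forward unfolding Y L_hat_iff by blast
  qed
  have brackets: "bracket_hat A B j (H \<circ> Psi) (F \<circ> Psi) \<gamma> = bracket A B j H F q" if f: "has_gradient F q f" for F f
  proof -
    have f': "f \<in> smooth_circle" using f by (simp add: has_gradient_def)
    have f2: "(\<lambda>x. 2 * L3 q f x) \<in> smooth_circle"
      by (intro smooth_circle_intros L3_smooth_circle q f')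
    \<comment> \<open>the bracket on curves pairs \<open>\<eta>\<close> with \<open>2 L\<^sub>3 f\<close>; moving \<open>L\<^sub>3\<close> across gives the pairing on functions\<close>
    have pairing: "circle_integral (\<lambda>x. \<eta> x * (2 * L3 q f x)) = circle_integral (\<lambda>x. - 2 * L3 q \<eta> x * f x)"
      if "\<eta> \<in> smooth_circle" for \<eta>
      using L3_skew[OF q that f'] circle_integral_mult[of "-2" "\<lambda>x. L3 q \<eta> x * f x"]
        circle_integral_mult[of 2 "\<lambda>x. \<eta> x * L3 q f x"]
      by (simp add: mult.left_commute mult.assoc)
    show ?thesis
    proof (intro equalityI subsetI)
      fix s assume "s \<in> bracket_hat A B j (H \<circ> Psi) (F \<circ> Psi) \<gamma>"
      then obtain \<eta> y2 where s: "s = - circle_integral (\<lambda>x. \<eta> x * y2 x)"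
        and y2: "tilde \<gamma> y2 = tilde \<gamma> (\<lambda>x. 2 * L3 q f x)"
        and hat: "(tilde \<gamma> (\<lambda>x. 2 * L3 q g x), tilde \<gamma> \<eta>) \<in> L_hat \<gamma> A B j"
        unfolding bracket_hat_def grad[OF assms(3)] grad[OF f] by blast
      obtain \<eta>' where "tilde \<gamma> \<eta> = tilde \<gamma> \<eta>'" "((\<lambda>x. 2 * L3 q g x), \<eta>') \<in> J_odd q A B j"
        using hat unfolding L_hat_iff by blast
      then have J: "((\<lambda>x. 2 * L3 q g x), \<eta>) \<in> J_odd q A B j"
        using tilde_inject[OF \<gamma>] by metis
      have "s = - circle_integral (\<lambda>x. - 2 * L3 q \<eta> x * f x)"
        unfolding s tilde_inject[OF \<gamma> y2] pairing[OF forward(1)[OF J]] by (rule refl)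
      then show "s \<in> bracket A B j H F q"
        unfolding bracket_def mem_Collect_eq
        by (intro exI[of _ "\<lambda>x. - 2 * L3 q \<eta> x"] exI[of _ g] exI[of _ f] conjI assms(3) f forward(2)[OF J])
    next
      fix s assume "s \<in> bracket A B j H F q"
      then obtain p f1 f2 where s: "s = - circle_integral (\<lambda>x. p x * f2 x)"
        and "has_gradient H q f1" "has_gradient F q f2" and L: "(f1, p) \<in> L_odd q A B j"
        unfolding bracket_def by blast
      then have f12: "f1 = g" "f2 = f"
        using has_gradient_unique[OF q] assms(3) f by blast+
      obtain \<eta> where J: "((\<lambda>x. 2 * L3 q g x), \<eta>) \<in> J_odd q A B j" and p: "p = (\<lambda>x. - 2 * L3 q \<eta> x)"
        by (rule L_odd_imp_J_odd[OF A B g sel L[unfolded f12]])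
      have "s = - circle_integral (\<lambda>x. \<eta> x * (2 * L3 q f x))"
        unfolding s f12 p pairing[OF forward(1)[OF J]] by (rule refl)
      moreover have "(tilde \<gamma> (\<lambda>x. 2 * L3 q g x), tilde \<gamma> \<eta>) \<in> L_hat \<gamma> A B j"
        using J unfolding L_hat_iff by blast
      ultimately show "s \<in> bracket_hat A B j (H \<circ> Psi) (F \<circ> Psi) \<gamma>"
        unfolding bracket_hat_def grad[OF assms(3)] grad[OF f] mem_Collect_eq
        by (intro exI[of _ \<eta>] exI[of _ "tilde \<gamma> (\<lambda>x. 2 * L3 q g x)"] exI[of _ "\<lambda>x. 2 * L3 q f x"]
            conjI forward(1)[OF J] f2 refl)
    qed
  qed
  show ?thesis
  proof (intro conjI)
    show "\<exists>!Y. has_gradient_M2 (H \<circ> Psi) \<gamma> Y"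
      unfolding grad[OF assms(3)] by simp
  qed (intro allI impI vector_fields, assumption, intro allI impI, elim exE, rule brackets)
qed

end
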